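(* Let $k$ be a field, let $m\geq 6$, let $S''=k[a_i,b_i,c_i,d,e]_{i=1}^m$ be a polynomial ring in $n=3m+2$ variables, with indices read modulo $m$, and let $F''$ be the element of the divided power ring $P$ associated to $S''$ that is dual to the polynomial $$\sum_{i=1}^m \left(a_ib_ic_i + a_ia_{i+1}^2 + b_ib_{i+1}^2 + c_ic_{i+1}^2 + a_ib_{i+1}d + b_ic_{i+1}e\right).$$ Then the apolar algebra $\mathrm{Apolar}(F'')=S''/\mathrm{Ann}(F'')$ satisfies the small tangent space condition.
   Context: Write $S=S''$. $P$ is the $k$-vector space with basis consisting of symbols $\mu^{*}$, one for each monomial $\mu$ of $S$ (the dual basis to the monomials of $S$), with $\deg\mu^*=\deg\mu$. $S$ acts on $P$ by contraction: for monomials $\nu,\mu$, $\nu\cdot\mu^{*}=(\mu/\nu)^{*}$ if $\nu$ divides $\mu$, and $0$ otherwise. The element of $P$ dual to a polynomial $\sum_\mu c_\mu\mu$ is $\sum_\mu c_\mu\mu^{*}$. For $f\in P$, $\mathrm{Ann}(f)=\{s\in S : s\cdot f=0\}$. For a graded $S$-module $M$ write $H(M)_i=\dim_k M_i$ ($S$ has the standard grading). "$M$ has Hilbert function $(h_0,\dots,h_j)$" means $H(M)_i=h_i$ for $0\le i\le j$ and $H(M)_i=0$ otherwise. Small tangent space condition ($n$ = number of variables of $S$): for $f\in P$ homogeneous of degree $3$ and $I=\mathrm{Ann}(f)$, $\mathrm{Apolar}(f)$ satisfies it if $S/I$ has Hilbert function $(1,n,n,1)$, $H(S/I^2)_4=n$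 and $H(S/I^2)_5=0$. *)

theory Defs
  imports
    "HOL-Library.Poly_Mapping"
    "HOL-Algebra.Embedded_Algebras"
    "HOL-Algebra.QuotRing"
    "HOL-Algebra.Ideal_Product"
begin

section \<open>Polynomial rings in a set of variables\<close>

text \<open>A monomial is its exponent vector, so multiplication of monomials is written additively.\<close>

type_synonym 'v monom = "'v \<Rightarrow>\<^sub>0 nat"
type_synonym ('v, 'k) mpol = "'v monom \<Rightarrow>\<^sub>0 'k"

definition mdeg :: "'v monom \<Rightarrow> nat" where
  "mdeg \<mu> = (\<Sum>v\<in>Poly_Mapping.keys \<mu>. Poly_Mapping.lookup \<mu> v)"

definition mdvd :: "'v monom \<Rightarrow> 'v monom \<Rightarrow> bool" where
  "mdvd \<nu> \<mu> \<longleftrightarrow> (\<exists>\<rho>. \<mu> = \<nu> + \<rho>)"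

definition indet :: "'v \<Rightarrow> ('v, 'k::field) mpol" where
  "indet v = Poly_Mapping.single (Poly_Mapping.single v 1) 1"

definition const_pol :: "'k::field \<Rightarrow> ('v, 'k) mpol" where
  "const_pol c = Poly_Mapping.single 0 c"

text \<open>The type \<open>('v, 'k) mpol\<close> is the polynomial ring in all elements of \<open>'v\<close>;
  \<open>pol_ring V\<close> is its subring \<open>k[V]\<close>.\<close>

definition pol_ring :: "'v set \<Rightarrow> ('v, 'k::field) mpol ring" where
  "pol_ring V = \<lparr>carrier = {p. \<forall>\<mu>\<in>Poly_Mapping.keys p. Poly_Mapping.keys \<mu> \<subseteq> V},
     monoid.mult = (*), one = 1, ring.zero = 0, add = (+)\<rparr>"

definition hom_part :: "'v set \<Rightarrow> nat \<Rightarrow> ('v, 'k::field) mpol set" where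
  "hom_part V i = {p \<in> carrier (pol_ring V). \<forall>\<mu>\<in>Poly_Mapping.keys p. mdeg \<mu> = i}"

lemma pol_ring_cring: "cring (pol_ring V :: ('v, 'k::field) mpol ring)"
proof (rule cringI)
  show "abelian_group (pol_ring V :: ('v, 'k) mpol ring)"
  proof (rule abelian_groupI)
    fix x y :: "('v, 'k) mpol"
    assume "x \<in> carrier (pol_ring V)" "y \<in> carrier (pol_ring V)"
    then show "x \<oplus>\<^bsub>pol_ring V\<^esub> y \<in> carrier (pol_ring V)"
      using keys_add[of x y] unfolding pol_ring_def by auto
  next
    fix x :: "('v, 'k) mpol"
    assume "x \<in> carrier (pol_ring V)"
    then show "\<exists>y\<in>carrier (pol_ring V). y \<oplus>\<^bsub>pol_ring V\<^esub> x = \<zero>\<^bsub>pol_ring V\<^esub>"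
      by (intro bexI[of _ "- x"]) (auto simp: pol_ring_def)
  qed (auto simp: pol_ring_def ac_simps)
  show "comm_monoid (pol_ring V :: ('v, 'k) mpol ring)"
  proof (rule comm_monoidI)
    fix x y :: "('v, 'k) mpol"
    assume "x \<in> carrier (pol_ring V)" "y \<in> carrier (pol_ring V)"
    then have xy: "Poly_Mapping.keys \<mu> \<subseteq> V"
      if "\<mu> \<in> Poly_Mapping.keys x \<or> \<mu> \<in> Poly_Mapping.keys y" for \<mu>
      using that unfolding pol_ring_def by auto
    have "Poly_Mapping.keys \<mu> \<subseteq> V" if \<mu>: "\<mu> \<in> Poly_Mapping.keys (x * y)" for \<mu>
    proof -
      obtain \<alpha> \<beta> where "\<mu> = \<alpha> + \<beta>" "\<alpha> \<in> Poly_Mapping.keys x" "\<beta> \<in> Poly_Mapping.keys y"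
        using \<mu> keys_mult[of x y] by blast
      then show ?thesis
        using keys_add[of \<alpha> \<beta>] xy[of \<alpha>] xy[of \<beta>] by blast
    qed
    then show "x \<otimes>\<^bsub>pol_ring V\<^esub> y \<in> carrier (pol_ring V)"
      unfolding pol_ring_def by simp
  qed (auto simp: pol_ring_def ac_simps)
qed (auto simp: pol_ring_def algebra_simps)


section \<open>The contraction module and apolar ideals\<close>

text \<open>\<open>Dual \<mu>\<close> is the symbol \<open>\<mu>\<^sup>*\<close>.\<close>

datatype 'v dual_monom = Dual "'v monom"

type_synonym ('v, 'k) dpol = "'v dual_monom \<Rightarrow>\<^sub>0 'k"

definition dual_module :: "'v set \<Rightarrow> ('v, 'k::field) dpol set" where
  "dual_module V = {f. \<forall>\<mu>. Dual \<mu> \<in> Poly_Mapping.keys f \<longrightarrow> Poly_Mapping.keys \<mu> \<subseteq> V}"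

definition dual_hom_part :: "'v set \<Rightarrow> nat \<Rightarrow> ('v, 'k::field) dpol set" where
  "dual_hom_part V i =
     {f \<in> dual_module V. \<forall>\<mu>. Dual \<mu> \<in> Poly_Mapping.keys f \<longrightarrow> mdeg \<mu> = i}"

text \<open>The bilinear extension of \<open>\<nu> \<cdot> \<mu>\<^sup>* = (\<mu>/\<nu>)\<^sup>*\<close> if \<open>\<nu>\<close> divides \<open>\<mu>\<close>, and \<open>0\<close> otherwise.\<close>

definition contract :: "('v, 'k::field) mpol \<Rightarrow> ('v, 'k) dpol \<Rightarrow> ('v, 'k) dpol" where
  "contract s f =
     (\<Sum>\<nu>\<in>Poly_Mapping.keys s. \<Sum>\<mu> | Dual \<mu> \<in> Poly_Mapping.keys f.
        if mdvd \<nu> \<mu>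
        then Poly_Mapping.single (Dual (\<mu> - \<nu>))
               (Poly_Mapping.lookup s \<nu> * Poly_Mapping.lookup f (Dual \<mu>))
        else 0)"

definition dual_of :: "('v, 'k::field) mpol \<Rightarrow> ('v, 'k) dpol" where
  "dual_of p =
     (\<Sum>\<mu>\<in>Poly_Mapping.keys p. Poly_Mapping.single (Dual \<mu>) (Poly_Mapping.lookup p \<mu>))"

definition Ann :: "'v set \<Rightarrow> ('v, 'k::field) dpol \<Rightarrow> ('v, 'k) mpol set" where
  "Ann V f = {s \<in> carrier (pol_ring V). contract s f = 0}"


section \<open>Hilbert functions of graded quotients\<close>

text \<open>For a proper homogeneous ideal \<open>I\<close> of \<open>S = k[V]\<close>: the copy of \<open>k\<close> inside the ring \<open>S/I\<close>,
  and the graded piece \<open>(S/I)\<^sub>i\<close>, the image of \<open>S\<^sub>i\<close>.\<close>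

definition quot_scalars :: "'v set \<Rightarrow> ('v, 'k::field) mpol set \<Rightarrow> ('v, 'k) mpol set set" where
  "quot_scalars V I = {I +>\<^bsub>pol_ring V\<^esub> const_pol c | c. True}"

definition quot_hom_part ::
    "'v set \<Rightarrow> ('v, 'k::field) mpol set \<Rightarrow> nat \<Rightarrow> ('v, 'k) mpol set set" where
  "quot_hom_part V I i = {I +>\<^bsub>pol_ring V\<^esub> s | s. s \<in> hom_part V i}"

text \<open>\<open>hilbert_value V I i h\<close> says \<open>H(S/I)\<^sub>i = h\<close>. It is a relation because \<open>ring.dimension\<close> is:
  the value includes the claim that \<open>(S/I)\<^sub>i\<close> is finite-dimensional.\<close>

definition hilbert_value :: "'v set \<Rightarrow> ('v, 'k::field) mpol set \<Rightarrow> nat \<Rightarrow> nat \<Rightarrow> bool" where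
  "hilbert_value V I i h \<longleftrightarrow>
     ring.dimension (pol_ring V Quot I) h (quot_scalars V I) (quot_hom_part V I i)"

definition has_hilbert_function :: "'v set \<Rightarrow> ('v, 'k::field) mpol set \<Rightarrow> nat list \<Rightarrow> bool" where
  "has_hilbert_function V I hs \<longleftrightarrow>
     (\<forall>i. hilbert_value V I i (if i < length hs then hs ! i else 0))"

definition small_tangent_space :: "'v set \<Rightarrow> ('v, 'k::field) dpol \<Rightarrow> bool" where
  "small_tangent_space V f \<longleftrightarrow>
     (let n = card V; I = Ann V f; I2 = ideal_prod (pol_ring V) I I in
       f \<in> dual_hom_part V 3 \<and>
       has_hilbert_function V I [1, n, n, 1] \<and>
       hilbert_value V I2 4 n \<and>
       hilbert_value V I2 5 0)"


section \<open>The cubic\<close>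

datatype cubic_var = VA nat | VB nat | VC nat | VD | VE

text \<open>The indices modulo \<open>m\<close> are represented by \<open>0, \<dots>, m - 1\<close>.\<close>

definition cubic_vars :: "nat \<Rightarrow> cubic_var set" where
  "cubic_vars m = VA ` {..<m} \<union> VB ` {..<m} \<union> VC ` {..<m} \<union> {VD, VE}"

lemma card_cubic_vars: "card (cubic_vars m) = 3 * m + 2"
proof -
  have c: "card (VA ` {..<m}) = m" "card (VB ` {..<m}) = m" "card (VC ` {..<m}) = m"
    by (simp_all add: card_image inj_on_def)
  have d: "VA ` {..<m} \<inter> VB ` {..<m} = {}"
    "(VA ` {..<m} \<union> VB ` {..<m}) \<inter> VC ` {..<m} = {}"
    "(VA ` {..<m} \<union> VB ` {..<m} \<union> VC ` {..<m}) \<inter> {VD, VE} = {}"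
    by auto
  show ?thesis
    unfolding cubic_vars_def
    by (simp add: card_Un_disjoint[OF _ _ d(3)] card_Un_disjoint[OF _ _ d(2)]
        card_Un_disjoint[OF _ _ d(1)] c del: Un_insert_right)
qed

definition cubic_pol :: "nat \<Rightarrow> (cubic_var, 'k::field) mpol" where
  "cubic_pol m =
     (let a = (\<lambda>i. indet (VA (i mod m))); b = (\<lambda>i. indet (VB (i mod m)));
          c = (\<lambda>i. indet (VC (i mod m))); d = indet VD; e = indet VE in
      \<Sum>i<m. a i * b i * c i
           + a i * a (i + 1) ^ 2 + b i * b (i + 1) ^ 2 + c i * c (i + 1) ^ 2
           + a i * b (i + 1) * d + b i * c (i + 1) * e)"

definition cubic_form :: "nat \<Rightarrow> (cubic_var, 'k::field) dpol" where
  "cubic_form m = dual_of (cubic_pol m)"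

end

theory Submission
  imports Defs "HOL-Library.Multiset"
begin

text \<open>A quadratic monomial contracts the cubic \<open>F\<close> to \<open>0\<close> or to a single \<open>z\<^sup>*\<close>, so the quadrics of
  \<open>I = Ann F\<close> are spanned by the monomials that kill \<open>F\<close> and by the differences \<open>q - q'\<close> of monomials
  with the same contraction. The products \<open>v\<^sup>* F\<close> in the divided power ring, one for each variable \<open>v\<close>,
  vanish on \<open>I\<^sup>2\<close> by the Leibniz rule, and they are dual to certain quartic monomials \<open>v t\<close> with \<open>t\<close> a term
  of \<open>F\<close>; hence \<open>(S/I\<^sup>2)\<^sub>4\<close> has dimension at least \<open>n\<close>. For the converse, the relations
  \<open>(q - q')(r - r') \<in> I\<^sup>2\<close> reduce every quartic monomial to these \<open>v t\<close>; the condition \<open>m \<ge> 6\<close> leaves enough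
  room to choose \<open>q'\<close> and \<open>r'\<close> away from the given variables. In degree 5, \<open>y v t\<close> lies in
  \<open>I\<^sup>2\<close> because \<open>t = z q\<close> for two different variables \<open>z\<close> with \<open>v z \<in> I\<close>, and \<open>y q \<in> I\<close> as soon as \<open>y \<noteq> z\<close>.\<close>

section \<open>Linear functionals on polynomials and Hilbert values\<close>

text \<open>Call a quadric null if it kills the cubic, and say that it has class \<open>v\<close> if
  it contracts the cubic to the dual of \<open>v\<close>. For a null quadric \<open>x y\<close> with
  \<open>x \<noteq> y\<close>, the functional of \<open>x\<close> takes the value 1 on
  \<open>x y\<close> times any quadric of class \<open>y\<close>. Such quartics must therefore
  survive modulo the square of the ideal, while \<open>x y\<close> times a class other than
  \<open>x\<close> and \<open>y\<close> must vanish. This dichotomy shapes the reduction. The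
  relation between two differences of quadrics trades one quartic for three, so it helps only if
  these three are settled already. Null pairs therefore precede the factors of class
  \<open>d\<close> or \<open>e\<close>, which have \<open>m\<close> representatives each, and the
  quartics in which all pairs divide terms come last. Each quartic \<open>v t\<close> is chosen with
  four distinct variables, so that its functional has the value 1 in every characteristic, and with
  \<open>v\<close> null against two variables of \<open>t\<close>. Since \<open>e\<close> is null
  with every a-variable and \<open>d\<close> with every c-variable, a fixed term \<open>t\<close>
  serves for these. A b-variable is null with neither \<open>d\<close> nor \<open>e\<close>, so its
  \<open>t\<close> has to move with the index.\<close>

abbreviation coeff :: "('v, 'k::zero) mpol \<Rightarrow> 'v monom \<Rightarrow> 'k" where
  "coeff \<equiv> Poly_Mapping.lookup"

section \<open>Ideals and cosets of the polynomial ring\<close>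

lemma pol_ring_simps [simp]:
  "monoid.mult (pol_ring V) = (*)" "one (pol_ring V) = 1" "ring.zero (pol_ring V) = 0"
  "add (pol_ring V) = (+)"
  by (simp_all add: pol_ring_def)

lemma carrier_pol_ring:
  "p \<in> carrier (pol_ring V) \<longleftrightarrow> (\<forall>\<mu>\<in>Poly_Mapping.keys p. Poly_Mapping.keys \<mu> \<subseteq> V)"
  by (simp add: pol_ring_def)

lemma pol_ring_ring: "ring (pol_ring V :: ('v, 'k::field) mpol ring)"
  using pol_ring_cring cring.axioms(1) by blast

lemma carrier_add:
  "p \<in> carrier (pol_ring V) \<Longrightarrow> q \<in> carrier (pol_ring V) \<Longrightarrow> p + q \<in> carrier (pol_ring V)"
  for p q :: "('v, 'k::field) mpol"
  using ring.ring_simprules(1)[OF pol_ring_ring, of p V q] by simp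

lemma carrier_mult:
  "p \<in> carrier (pol_ring V) \<Longrightarrow> q \<in> carrier (pol_ring V) \<Longrightarrow> p * q \<in> carrier (pol_ring V)"
  for p q :: "('v, 'k::field) mpol"
  using ring.ring_simprules(5)[OF pol_ring_ring, of p V q] by simp

lemma carrier_uminus: "p \<in> carrier (pol_ring V) \<Longrightarrow> - p \<in> carrier (pol_ring V)"
  for p :: "('v, 'k::field) mpol"
  by (simp add: carrier_pol_ring)

lemma carrier_const: "const_pol c \<in> carrier (pol_ring V)"
  by (simp add: carrier_pol_ring const_pol_def)

lemma carrier_sum: "(\<And>a. a \<in> A \<Longrightarrow> f a \<in> carrier (pol_ring V)) \<Longrightarrow> sum f A \<in> carrier (pol_ring V)"
  for f :: "'a \<Rightarrow> ('v, 'k::field) mpol"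
proof (induction A rule: infinite_finite_induct)
  case (insert x F)
  then show ?case by (simp add: carrier_add)
qed (simp_all add: carrier_pol_ring)

lemma a_inv_pol_ring: "p \<in> carrier (pol_ring V) \<Longrightarrow> \<ominus>\<^bsub>pol_ring V\<^esub> p = - p"
  for p :: "('v, 'k::field) mpol"
  by (rule abelian_group.minus_equality[OF ring.is_abelian_group[OF pol_ring_ring]])
    (simp_all add: carrier_uminus)

lemma ideal_pol_ringI:
  fixes I :: "('v, 'k::field) mpol set"
  assumes "I \<subseteq> carrier (pol_ring V)" "0 \<in> I" "\<And>p q. p \<in> I \<Longrightarrow> q \<in> I \<Longrightarrow> p + q \<in> I"
    "\<And>p q. p \<in> I \<Longrightarrow> q \<in> carrier (pol_ring V) \<Longrightarrow> q * p \<in> I"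
  shows "ideal I (pol_ring V)"
proof (rule idealI[OF pol_ring_ring])
  have u: "- p \<in> I" if "p \<in> I" for p
    using assms(4)[OF that, of "- 1"] by (simp add: carrier_pol_ring)
  interpret ring "pol_ring V :: ('v, 'k) mpol ring" by (rule pol_ring_ring)
  show "subgroup I (add_monoid (pol_ring V))"
    by (rule add.subgroupI) (use assms u in \<open>auto simp: a_inv_def[symmetric] a_inv_pol_ring subset_iff\<close>)
qed (use assms in \<open>auto simp: mult.commute\<close>)

lemma
  fixes I :: "('v, 'k::field) mpol set"
  assumes "ideal I (pol_ring V)"
  shows ideal_zero: "0 \<in> I"
    and ideal_add: "p \<in> I \<Longrightarrow> q \<in> I \<Longrightarrow> p + q \<in> I"
    and ideal_mult: "p \<in> I \<Longrightarrow> q \<in> carrier (pol_ring V) \<Longrightarrow> q * p \<in> I"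
proof -
  interpret ideal I "pol_ring V" by fact
  show "0 \<in> I" using additive_subgroup.zero_closed[OF is_additive_subgroup] by simp
  show "p + q \<in> I" if "p \<in> I" "q \<in> I" for p q
    using additive_subgroup.a_closed[OF is_additive_subgroup that] by simp
  show "q * p \<in> I" if "p \<in> I" "q \<in> carrier (pol_ring V)" for p q using I_l_closed[OF that] by simp
qed

lemma ideal_sum:
  fixes I :: "('v, 'k::field) mpol set"
  assumes "ideal I (pol_ring V)" "\<And>a. a \<in> A \<Longrightarrow> f a \<in> I"
  shows "sum f A \<in> I"
  using assms(2)
proof (induction A rule: infinite_finite_induct)
  case (insert x F)
  then show ?case by (simp add: ideal_add[OF assms(1)])
qed (simp_all add: ideal_zero[OF assms(1)])

lemma coset_eq_iff:
  fixes I :: "('v, 'k::field) mpol set"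
  assumes "ideal I (pol_ring V)" "p \<in> carrier (pol_ring V)" "q \<in> carrier (pol_ring V)"
  shows "I +>\<^bsub>pol_ring V\<^esub> p = I +>\<^bsub>pol_ring V\<^esub> q \<longleftrightarrow> p - q \<in> I"
  using ring.quotient_eq_iff_same_a_r_cos[OF pol_ring_ring assms] assms a_inv_pol_ring[of q V]
  by (simp add: a_minus_def)

text \<open>\<open>ring.dimension\<close> enlarges a space by one line extension at a time.
  Computing the extension on representatives lets the later induction work with polynomials in place
  of cosets.\<close>

lemma quot_line_extension:
  fixes I :: "('v, 'k::field) mpol set"
  assumes I: "ideal I (pol_ring V)" and b: "b \<in> carrier (pol_ring V)" and W: "W \<subseteq> carrier (pol_ring V)"
  defines "cs \<equiv> \<lambda>p. I +>\<^bsub>pol_ring V\<^esub> p"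
  shows "ring.line_extension (pol_ring V Quot I) (quot_scalars V I) (cs b) (cs ` W) =
    cs ` {const_pol c * b + w | c w. w \<in> W}"
proof -
  interpret I: ideal I "pol_ring V" by fact
  interpret Q: ring "pol_ring V Quot I" by (rule I.quotient_is_ring)
  have eq: "cs (const_pol c) \<otimes>\<^bsub>pol_ring V Quot I\<^esub> cs b \<oplus>\<^bsub>pol_ring V Quot I\<^esub> cs w = cs (const_pol c * b + w)"
    if "w \<in> W" for c w
  proof -
    have w: "w \<in> carrier (pol_ring V)" using that W by blast
    show ?thesis
      using I.rcoset_mult_add[OF carrier_const b, of c] I.a_rcos_sum[OF carrier_mult[OF carrier_const b, of c] w]
      unfolding cs_def by (simp add: FactRing_def)
  qed
  show ?thesis
  proof (rule Set.set_eqI)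
    fix u
    have "u \<in> Q.line_extension (quot_scalars V I) (cs b) (cs ` W) \<longleftrightarrow>
        (\<exists>c. \<exists>w\<in>W. u = cs (const_pol c) \<otimes>\<^bsub>pol_ring V Quot I\<^esub> cs b \<oplus>\<^bsub>pol_ring V Quot I\<^esub> cs w)"
      unfolding Q.line_extension_mem_iff quot_scalars_def cs_def by blast
    also have "\<dots> \<longleftrightarrow> u \<in> cs ` {const_pol c * b + w | c w. w \<in> W}"
      using eq by (auto simp: image_iff)
    finally show "u \<in> Q.line_extension (quot_scalars V I) (cs b) (cs ` W) \<longleftrightarrow>
      u \<in> cs ` {const_pol c * b + w | c w. w \<in> W}" .
  qed
qed

section \<open>Linear functionals on polynomials, given by arbitrary values at the monomials\<close>

definition lin :: "('v monom \<Rightarrow> 'k) \<Rightarrow> ('v, 'k::field) mpol \<Rightarrow> 'k" where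
  "lin g p = (\<Sum>\<mu>\<in>Poly_Mapping.keys p. coeff p \<mu> * g \<mu>)"

lemma lin_superset:
  assumes "finite A" "Poly_Mapping.keys p \<subseteq> A"
  shows "lin g p = (\<Sum>\<mu>\<in>A. coeff p \<mu> * g \<mu>)"
  unfolding lin_def using assms by (intro sum.mono_neutral_left) (auto simp: in_keys_iff)

lemma lin_zero [simp]: "lin g 0 = 0"
  by (simp add: lin_def)

lemma lin_add: "lin g (p + q) = lin g p + lin g q"
proof -
  let ?A = "Poly_Mapping.keys p \<union> Poly_Mapping.keys q"
  have "lin g (p + q) = (\<Sum>\<mu>\<in>?A. coeff (p + q) \<mu> * g \<mu>)"
    using keys_add[of p q] by (intro lin_superset) auto
  also have "\<dots> = (\<Sum>\<mu>\<in>?A. coeff p \<mu> * g \<mu>) + (\<Sum>\<mu>\<in>?A. coeff q \<mu> * g \<mu>)"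
    by (simp add: lookup_add distrib_right sum.distrib)
  finally show ?thesis
    using lin_superset[of ?A p g] lin_superset[of ?A q g] by simp
qed

lemma lin_sum: "lin g (sum f A) = (\<Sum>a\<in>A. lin g (f a))"
  by (induction A rule: infinite_finite_induct) (auto simp: lin_add)

lemma lin_uminus: "lin g (- p) = - lin g p"
  using lin_add[of g p "- p"] by (simp add: eq_neg_iff_add_eq_0 add.commute)

lemma lin_diff: "lin g (p - q) = lin g p - lin g q"
  using lin_add[of g p "- q"] by (simp add: lin_uminus)

lemma lin_single [simp]: "lin g (Poly_Mapping.single \<mu> c) = c * g \<mu>"
  by (simp add: lin_def)

lemma pol_expand: "p = (\<Sum>\<mu>\<in>Poly_Mapping.keys p. Poly_Mapping.single \<mu> (coeff p \<mu>))"
  by (rule poly_mapping_eqI)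
    (auto simp: lookup_sum lookup_single when_def in_keys_iff sum.delta' if_distrib cong: if_cong)

text \<open>Nesting the functionals freezes one factor at a time: membership of \<open>q\<close> in
  an ideal can be used separately for each monomial \<open>\<alpha>\<close> of
  \<open>p\<close>.\<close>

lemma lin_mult: "lin g (p * q) = lin (\<lambda>\<alpha>. lin (\<lambda>\<beta>. g (\<alpha> + \<beta>)) q) p"
proof -
  have "p * q = (\<Sum>\<alpha>\<in>Poly_Mapping.keys p. \<Sum>\<beta>\<in>Poly_Mapping.keys q.
      Poly_Mapping.single (\<alpha> + \<beta>) (coeff p \<alpha> * coeff q \<beta>))"
    by (subst (1) pol_expand[of p], subst (1) pol_expand[of q]) (simp add: sum_product mult_single)
  then show ?thesis
    by (simp add: lin_sum) (simp add: lin_def sum_distrib_left mult.assoc)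
qed

lemma lin_swap: "lin (\<lambda>\<alpha>. lin (g \<alpha>) q) p = lin (\<lambda>\<beta>. lin (\<lambda>\<alpha>. g \<alpha> \<beta>) p) q"
  unfolding lin_def sum_distrib_left by (subst sum.swap) (simp add: mult.left_commute)

lemma lin_const_mult: "lin g (const_pol c * p) = c * lin g p"
  by (simp add: const_pol_def lin_mult)

lemma lin_fun_mult: "lin (\<lambda>\<mu>. c * g \<mu>) p = c * lin g p"
  by (simp add: lin_def sum_distrib_left mult.left_commute)

lemma lin_fun_add: "lin (\<lambda>\<mu>. g \<mu> + h \<mu>) p = lin g p + lin h p"
  by (simp add: lin_def distrib_left sum.distrib)

lemma lin_fun_zero: "(\<And>\<mu>. \<mu> \<in> Poly_Mapping.keys p \<Longrightarrow> g \<mu> = 0) \<Longrightarrow> lin g p = 0"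
  by (simp add: lin_def)

lemma const_pol_mult_single: "const_pol c * Poly_Mapping.single \<mu> d = Poly_Mapping.single \<mu> (c * d)"
  by (simp add: const_pol_def mult_single)

lemma hom_part_const_mult: "s \<in> hom_part V i \<Longrightarrow> const_pol c * s \<in> hom_part V i"
proof -
  assume s: "s \<in> hom_part V i"
  have "Poly_Mapping.keys (const_pol c * s) \<subseteq> Poly_Mapping.keys s"
    using keys_mult[of "const_pol c" s] by (auto simp: const_pol_def split: if_splits)
  then show ?thesis using s unfolding hom_part_def carrier_pol_ring by blast
qed

lemma hom_part_diff: "s \<in> hom_part V i \<Longrightarrow> t \<in> hom_part V i \<Longrightarrow> s - t \<in> hom_part V i"
  using keys_diff[of s t] unfolding hom_part_def carrier_pol_ring by blast

lemma hom_part_sum: "(\<And>a. a \<in> A \<Longrightarrow> f a \<in> hom_part V i) \<Longrightarrow> sum f A \<in> hom_part V i"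
  using keys_sum[of f A] unfolding hom_part_def carrier_pol_ring by blast

text \<open>A dual basis argument. The functionals \<open>g a\<close> descend to the quotient, and
  duality makes the classes of the \<open>b a\<close> independent. Subtracting from \<open>s\<close>
  the combination with coefficients \<open>lin (g a) s\<close> leaves an element killed by all
  functionals, which \<open>complete\<close> puts into the ideal.\<close>

lemma hilbert_valueI:
  fixes I :: "('v, 'k::field) mpol set" and b :: "'a \<Rightarrow> ('v, 'k) mpol"
  assumes I: "ideal I (pol_ring V)" and A: "finite A"
    and b: "\<And>a. a \<in> A \<Longrightarrow> b a \<in> hom_part V i"
    and vanish: "\<And>a s. a \<in> A \<Longrightarrow> s \<in> I \<Longrightarrow> lin (g a) s = 0"
    and dual: "\<And>a a'. a \<in> A \<Longrightarrow> a' \<in> A \<Longrightarrow> lin (g a) (b a') = of_bool (a = a')"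
    and complete: "\<And>s. s \<in> hom_part V i \<Longrightarrow> (\<And>a. a \<in> A \<Longrightarrow> lin (g a) s = 0) \<Longrightarrow> s \<in> I"
  shows "hilbert_value V I i (card A)"
proof -
  define cs where "cs = (\<lambda>p. I +>\<^bsub>pol_ring V\<^esub> p)"
  define W where "W = (\<lambda>B. {\<Sum>a\<in>B. const_pol (c a) * b a | c. True})"
  interpret I: ideal I "pol_ring V" by fact
  interpret Q: ring "pol_ring V Quot I" by (rule I.quotient_is_ring)
  have hom_carrier: "s \<in> carrier (pol_ring V)" if "s \<in> hom_part V i" for s :: "('v, 'k) mpol"
    using that by (simp add: hom_part_def)
  have W_carrier: "W B \<subseteq> carrier (pol_ring V)" if "B \<subseteq> A" for B
  proof -
    have "const_pol c * b a \<in> carrier (pol_ring V)" if "a \<in> B" for a c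
      using that \<open>B \<subseteq> A\<close> by (intro carrier_mult carrier_const hom_carrier b) blast
    then show ?thesis unfolding W_def by (blast intro: carrier_sum)
  qed
  have lin_W: "lin (g a) (\<Sum>a\<in>B. const_pol (c a) * b a) = (if a \<in> B then c a else 0)"
    if "B \<subseteq> A" "a \<in> A" for a B c
  proof -
    have "lin (g a) (\<Sum>a\<in>B. const_pol (c a) * b a) = (\<Sum>a'\<in>B. if a = a' then c a' else 0)"
      unfolding lin_sum lin_const_mult using that by (intro sum.cong) (auto simp: dual)
    then show ?thesis using finite_subset[OF that(1) A] by simp
  qed
  have "Q.dimension (card B) (quot_scalars V I) (cs ` W B)" if "finite B" "B \<subseteq> A" for B
    using that
  proof (induction B)
    case empty
    have "cs ` W {} = {\<zero>\<^bsub>pol_ring V Quot I\<^esub>}"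
      using I.a_coset_add_zero[OF I.a_subset] by (simp add: W_def cs_def FactRing_def)
    then show ?case using Q.zero_dim[of "quot_scalars V I"] by simp
  next
    case (insert x B)
    have x: "b x \<in> carrier (pol_ring V)"
      using insert.prems b hom_carrier by blast
    \<comment> \<open>The functional \<open>g x\<close> separates \<open>b x\<close> from the
      earlier span: it is 1 on \<open>b x\<close> and 0 on both \<open>W B\<close> and the
      ideal.\<close>
    have "cs (b x) \<notin> cs ` W B"
    proof
      assume "cs (b x) \<in> cs ` W B"
      then obtain w where w: "w \<in> W B" "cs (b x) = cs w" by blast
      then have "b x - w \<in> I"
        using coset_eq_iff[OF I x, of w] W_carrier[of B] insert.prems unfolding cs_def by blast
      then have "lin (g x) (b x - w) = 0"
        using vanish insert.prems by blast
      moreover obtain c where "w = (\<Sum>a\<in>B. const_pol (c a) * b a)"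
        using w(1) unfolding W_def by blast
      ultimately show False
        using lin_W[of B x c] insert by (simp add: lin_diff dual)
    qed
    moreover have "cs (b x) \<in> carrier (pol_ring V Quot I)"
      unfolding cs_def FactRing_def using I.a_rcosetsI[OF I.a_subset x] by simp
    ultimately have dim: "Q.dimension (Suc (card B)) (quot_scalars V I)
        (Q.line_extension (quot_scalars V I) (cs (b x)) (cs ` W B))"
      using insert by (intro Q.Suc_dim) auto
    have W_insert: "{const_pol c * b x + w | c w. w \<in> W B} = W (insert x B)"
    proof -
      have "const_pol c * b x + (\<Sum>a\<in>B. const_pol (d a) * b a) \<in> W (insert x B)" for c d
        unfolding W_def mem_Collect_eq
        by (rule exI[of _ "d(x := c)"]) (use insert in \<open>auto intro!: sum.cong\<close>)
      moreover have "(\<Sum>a\<in>insert x B. const_pol (c a) * b a) = const_pol (c x) * b x + (\<Sum>a\<in>B. const_pol (c a) * b a)" for c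
        using insert by simp
      ultimately show ?thesis unfolding W_def by blast
    qed
    have line: "Q.line_extension (quot_scalars V I) (cs (b x)) (cs ` W B) = cs ` W (insert x B)"
      using quot_line_extension[OF I x W_carrier[of B]] insert.prems unfolding cs_def W_insert by blast
    show ?case
      using dim unfolding line card_insert_disjoint[OF insert.hyps(1,2)] .
  qed
  then have "Q.dimension (card A) (quot_scalars V I) (cs ` W A)"
    using A by blast
  moreover have "cs ` W A = quot_hom_part V I i"
  proof -
    have sum_hom: "(\<Sum>a\<in>A. const_pol (c a) * b a) \<in> hom_part V i" for c
      by (intro hom_part_sum hom_part_const_mult b)
    then have W_hom: "W A \<subseteq> hom_part V i"
      unfolding W_def by blast
    have "cs s \<in> cs ` W A" if s: "s \<in> hom_part V i" for s
    proof -
      let ?w = "\<Sum>a\<in>A. const_pol (lin (g a) s) * b a"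
      have w: "?w \<in> hom_part V i" by (rule sum_hom)
      have "s - ?w \<in> hom_part V i"
        using s w by (rule hom_part_diff)
      then have "s - ?w \<in> I"
        by (rule complete) (simp add: lin_diff lin_W)
      then have "cs s = cs ?w"
        using coset_eq_iff[OF I hom_carrier[OF s] hom_carrier[OF w]] unfolding cs_def by simp
      moreover have "?w \<in> W A"
        unfolding W_def mem_Collect_eq by (rule exI[of _ "\<lambda>a. lin (g a) s"]) simp
      ultimately show ?thesis by (rule image_eqI)
    qed
    then have "cs ` W A = cs ` hom_part V i"
      using W_hom by (intro equalityI image_mono image_subsetI)
    then show ?thesis
      unfolding quot_hom_part_def cs_def Setcompr_eq_image .
  qed
  ultimately show ?thesis unfolding hilbert_value_def by simp
qed

text \<open>Divisibility with quotient \<open>\<rho>\<close> is the equation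
  \<open>\<mu> = \<nu> + \<rho>\<close>. The truncated subtraction in \<open>contract\<close> thus
  disappears, and contraction becomes a family of functionals indexed by
  \<open>\<rho>\<close>.\<close>

lemma lookup_contract:
  "Poly_Mapping.lookup (contract s f) (Dual \<rho>) = lin (\<lambda>\<nu>. Poly_Mapping.lookup f (Dual (\<nu> + \<rho>))) s"
proof -
  have fin: "finite {\<mu>. Dual \<mu> \<in> Poly_Mapping.keys f}"
    using finite_vimageI[OF finite_keys[of f], of Dual] by (simp add: vimage_def inj_def)
  have "Poly_Mapping.lookup (if mdvd \<nu> \<mu> then Poly_Mapping.single (Dual (\<mu> - \<nu>))
               (coeff s \<nu> * Poly_Mapping.lookup f (Dual \<mu>)) else 0) (Dual \<rho>) =
      (if \<mu> = \<nu> + \<rho> then coeff s \<nu> * Poly_Mapping.lookup f (Dual \<mu>) else 0)" for \<nu> \<mu>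
  proof (cases "mdvd \<nu> \<mu>")
    case True
    then obtain \<sigma> where "\<mu> = \<nu> + \<sigma>" unfolding mdvd_def by blast
    then show ?thesis using True by (simp add: lookup_single when_def)
  next
    case False
    then have "\<mu> \<noteq> \<nu> + \<rho>" unfolding mdvd_def by blast
    then show ?thesis using False by simp
  qed
  then have "Poly_Mapping.lookup (contract s f) (Dual \<rho>) = (\<Sum>\<nu>\<in>Poly_Mapping.keys s.
      \<Sum>\<mu> | Dual \<mu> \<in> Poly_Mapping.keys f. if \<mu> = \<nu> + \<rho> then coeff s \<nu> * Poly_Mapping.lookup f (Dual \<mu>) else 0)"
    unfolding contract_def lookup_sum by presburger
  also have "\<dots> = lin (\<lambda>\<nu>. Poly_Mapping.lookup f (Dual (\<nu> + \<rho>))) s"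
    unfolding lin_def sum.delta[OF fin] by (intro sum.cong) (simp_all add: in_keys_iff)
  finally show ?thesis .
qed

lemma contract_eq_0_iff:
  "contract s f = 0 \<longleftrightarrow> (\<forall>\<rho>. lin (\<lambda>\<nu>. Poly_Mapping.lookup f (Dual (\<nu> + \<rho>))) s = 0)"
proof -
  have "contract s f = 0 \<longleftrightarrow> (\<forall>\<rho>. Poly_Mapping.lookup (contract s f) (Dual \<rho>) = 0)"
  proof
    assume *: "\<forall>\<rho>. Poly_Mapping.lookup (contract s f) (Dual \<rho>) = 0"
    show "contract s f = 0"
    proof (rule poly_mapping_eqI)
      fix x show "Poly_Mapping.lookup (contract s f) x = Poly_Mapping.lookup 0 x"
        using * by (cases x) simp
    qed
  qed simp
  then show ?thesis by (simp add: lookup_contract)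
qed

text \<open>Multiplication by a monomial \<open>\<alpha>\<close> only shifts the index
  \<open>\<rho>\<close> of the defining functionals by \<open>\<alpha>\<close>.\<close>

lemma ideal_Ann:
  fixes f :: "('v, 'k::field) dpol"
  shows "ideal (Ann V f) (pol_ring V)"
proof (rule ideal_pol_ringI)
  fix p q :: "('v, 'k) mpol" assume p: "p \<in> Ann V f" and q: "q \<in> carrier (pol_ring V)"
  have "lin (\<lambda>\<nu>. Poly_Mapping.lookup f (Dual (\<alpha> + \<nu> + \<rho>))) p = 0" for \<alpha> \<rho>
  proof -
    have "\<alpha> + \<nu> + \<rho> = \<nu> + (\<alpha> + \<rho>)" for \<nu>
      by (simp add: ac_simps)
    then show ?thesis
      using p unfolding Ann_def contract_eq_0_iff by simp
  qed
  then have "lin (\<lambda>\<nu>. Poly_Mapping.lookup f (Dual (\<nu> + \<rho>))) (q * p) = 0" for \<rho>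
    unfolding lin_mult by (simp add: lin_def)
  then show "q * p \<in> Ann V f"
    using p q unfolding Ann_def contract_eq_0_iff by (simp add: carrier_mult)
qed (simp_all add: Ann_def contract_eq_0_iff carrier_add lin_add carrier_pol_ring[of 0] subset_iff)

lemma lookup_dual_of: "Poly_Mapping.lookup (dual_of p) (Dual \<mu>) = coeff p \<mu>"
  unfolding dual_of_def lookup_sum
  by (auto simp: lookup_single when_def in_keys_iff)

text \<open>Multisets give explicit monomials such as \<open>{#x, y, z#}\<close> a form in which
  equality, degree and exponents are computed by simplification.\<close>

definition monom_of :: "'v multiset \<Rightarrow> 'v monom" where
  "monom_of M = (\<Sum>x\<in>#M. Poly_Mapping.single x 1)"

lemma monom_of_empty: "monom_of {#} = 0"
  by (simp add: monom_of_def)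

lemma monom_of_add_mset: "monom_of (add_mset x M) = Poly_Mapping.single x 1 + monom_of M"
  by (simp add: monom_of_def)

lemma monom_of_union: "monom_of (M + N) = monom_of M + monom_of N"
  by (simp add: monom_of_def)

lemma lookup_monom_of [simp]: "Poly_Mapping.lookup (monom_of M) v = count M v"
  by (induction M) (simp_all add: monom_of_empty monom_of_add_mset lookup_add lookup_single when_def)

lemma monom_of_eq_iff [simp]: "monom_of M = monom_of N \<longleftrightarrow> M = N"
  by (metis lookup_monom_of multiset_eqI)

lemma monom_of_exhaust: obtains M where "\<mu> = monom_of M"
proof -
  have "\<mu> = monom_of (\<Sum>v\<in>Poly_Mapping.keys \<mu>. replicate_mset (Poly_Mapping.lookup \<mu> v) v)"
    by (rule poly_mapping_eqI) (auto simp: count_sum in_keys_iff)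
  then show ?thesis by (rule that)
qed

lemma keys_monom_of [simp]: "Poly_Mapping.keys (monom_of M) = set_mset M"
  by (auto simp: in_keys_iff)

lemma mdeg_monom_of [simp]: "mdeg (monom_of M) = size M"
  by (simp add: mdeg_def size_multiset_overloaded_eq)

definition monom_pol :: "'v multiset \<Rightarrow> ('v, 'k::field) mpol" where
  "monom_pol M = Poly_Mapping.single (monom_of M) 1"

lemma monom_pol_mult: "monom_pol M * monom_pol N = monom_pol (M + N)"
  by (simp add: monom_pol_def mult_single monom_of_union)

lemma indet_eq_monom_pol: "indet v = monom_pol {#v#}"
  by (simp add: indet_def monom_pol_def monom_of_add_mset monom_of_empty)

lemma monom_pol_carrier: "set_mset M \<subseteq> V \<Longrightarrow> monom_pol M \<in> carrier (pol_ring V)"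
  by (simp add: carrier_pol_ring monom_pol_def)

lemma monom_pol_hom_part: "set_mset M \<subseteq> V \<Longrightarrow> size M = i \<Longrightarrow> monom_pol M \<in> hom_part V i"
  by (simp add: hom_part_def monom_pol_carrier) (simp add: monom_pol_def)

lemma lin_monom_pol [simp]: "lin g (monom_pol M) = g (monom_of M)"
  by (simp add: monom_pol_def)

lemma hom_part_key_mset:
  assumes "s \<in> hom_part V i" "\<mu> \<in> Poly_Mapping.keys s"
  obtains M where "\<mu> = monom_of M" "size M = i" "set_mset M \<subseteq> V"
proof -
  obtain M where "\<mu> = monom_of M" by (rule monom_of_exhaust)
  moreover have "Poly_Mapping.keys \<mu> \<subseteq> V" "mdeg \<mu> = i"
    using assms by (simp_all add: hom_part_def carrier_pol_ring)
  ultimately show ?thesis using that[of M] by simp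
qed

lemma lin_hom_part_eq_0:
  assumes "s \<in> hom_part V i" "\<And>M. size M = i \<Longrightarrow> set_mset M \<subseteq> V \<Longrightarrow> g (monom_of M) = 0"
  shows "lin g s = 0"
proof (rule lin_fun_zero)
  fix \<mu> assume "\<mu> \<in> Poly_Mapping.keys s"
  then obtain M where "\<mu> = monom_of M" "size M = i" "set_mset M \<subseteq> V"
    by (rule hom_part_key_mset[OF assms(1)])
  then show "g \<mu> = 0" using assms(2) by simp
qed

lemma hom_part_induct:
  assumes s: "s \<in> hom_part V i" and zero: "Q 0"
    and add: "\<And>p q. Q p \<Longrightarrow> Q q \<Longrightarrow> Q (p + q)"
    and monomial: "\<And>M c. size M = i \<Longrightarrow> set_mset M \<subseteq> V \<Longrightarrow> Q (const_pol c * monom_pol M)"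
  shows "Q s"
proof -
  have "Q (\<Sum>\<mu>\<in>B. Poly_Mapping.single \<mu> (coeff s \<mu>))" if "finite B" "B \<subseteq> Poly_Mapping.keys s" for B
    using that
  proof (induction B)
    case (insert \<mu> B)
    obtain M where M: "\<mu> = monom_of M" "size M = i" "set_mset M \<subseteq> V"
      using insert.prems by (auto intro: hom_part_key_mset[OF s])
    have "Poly_Mapping.single \<mu> (coeff s \<mu>) = const_pol (coeff s \<mu>) * monom_pol M"
      by (simp add: M(1) monom_pol_def const_pol_mult_single)
    then show ?case using insert monomial[OF M(2,3)] add by simp
  qed (simp add: zero)
  from this[OF finite_keys order_refl] show ?thesis
    using pol_expand[of s] by simp
qed

lemma lin_hom_part_cong:
  assumes "s \<in> hom_part V i" "\<And>M. size M = i \<Longrightarrow> set_mset M \<subseteq> V \<Longrightarrow> g (monom_of M) = h (monom_of M)"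
  shows "lin g s = lin h s"
proof -
  have "lin (\<lambda>\<mu>. g \<mu> + (- 1) * h \<mu>) s = 0"
    by (rule lin_hom_part_eq_0[OF assms(1)]) (simp add: assms(2))
  then show ?thesis
    unfolding lin_fun_add lin_fun_mult by simp
qed

section \<open>The multiplication table of the cubic\<close>

text \<open>Case distinctions in place of \<open>mod\<close> keep the index computations within
  linear arithmetic.\<close>

definition nxt :: "nat \<Rightarrow> nat \<Rightarrow> nat" where "nxt m i = (if Suc i = m then 0 else Suc i)"
definition prv :: "nat \<Rightarrow> nat \<Rightarrow> nat" where "prv m i = (if i = 0 then m - 1 else i - 1)"

text \<open>\<open>third m x y = Some z\<close> says that \<open>x y z\<close> is a term of the cubic; no quadratic monomial divides two
  terms with different third factors. If there is no such \<open>z\<close>, the quadric \<open>x y\<close> is in the apolar ideal.\<close>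

fun third :: "nat \<Rightarrow> cubic_var \<Rightarrow> cubic_var \<Rightarrow> cubic_var option" where
  "third m (VA i) (VA j) = (if j = nxt m i then Some (VA j) else if i = nxt m j then Some (VA i)
     else if i = j then Some (VA (prv m i)) else None)"
| "third m (VB i) (VB j) = (if j = nxt m i then Some (VB j) else if i = nxt m j then Some (VB i)
     else if i = j then Some (VB (prv m i)) else None)"
| "third m (VC i) (VC j) = (if j = nxt m i then Some (VC j) else if i = nxt m j then Some (VC i)
     else if i = j then Some (VC (prv m i)) else None)"
| "third m (VA i) (VB j) = (if i = j then Some (VC i) else if j = nxt m i then Some VD else None)"
| "third m (VB j) (VA i) = (if i = j then Some (VC i) else if j = nxt m i then Some VD else None)"
| "third m (VB i) (VC j) = (if i = j then Some (VA i) else if j = nxt m i then Some VE else None)"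
| "third m (VC j) (VB i) = (if i = j then Some (VA i) else if j = nxt m i then Some VE else None)"
| "third m (VA i) (VC j) = (if i = j then Some (VB i) else None)"
| "third m (VC j) (VA i) = (if i = j then Some (VB i) else None)"
| "third m (VA i) VD = Some (VB (nxt m i))"
| "third m VD (VA i) = Some (VB (nxt m i))"
| "third m (VB i) VD = Some (VA (prv m i))"
| "third m VD (VB i) = Some (VA (prv m i))"
| "third m (VB i) VE = Some (VC (nxt m i))"
| "third m VE (VB i) = Some (VC (nxt m i))"
| "third m (VC i) VE = Some (VB (prv m i))"
| "third m VE (VC i) = Some (VB (prv m i))"
| "third m _ _ = None"

locale cubic_indices =
  fixes m :: nat
  assumes six: "6 \<le> m"
begin

abbreviation "S \<equiv> nxt m"
abbreviation "P \<equiv> prv m"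
abbreviation "V \<equiv> cubic_vars m"
abbreviation "T \<equiv> third m"

lemma mem_V [simp]: "VA i \<in> V \<longleftrightarrow> i < m" "VB i \<in> V \<longleftrightarrow> i < m" "VC i \<in> V \<longleftrightarrow> i < m" "VD \<in> V" "VE \<in> V"
  by (auto simp: cubic_vars_def)

lemma nxt_less [simp]: "i < m \<Longrightarrow> S i < m" and prv_less [simp]: "i < m \<Longrightarrow> P i < m"
  by (auto simp: nxt_def prv_def)

lemma nxt_prv [simp]: "i < m \<Longrightarrow> S (P i) = i" and prv_nxt [simp]: "i < m \<Longrightarrow> P (S i) = i"
  by (auto simp: nxt_def prv_def)

lemma nxt_inj [simp]: "i < m \<Longrightarrow> j < m \<Longrightarrow> S i = S j \<longleftrightarrow> i = j"
  by (auto simp: nxt_def)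

lemma prv_eq [simp]: "i < m \<Longrightarrow> j < m \<Longrightarrow> P i = j \<longleftrightarrow> i = S j" "i < m \<Longrightarrow> j < m \<Longrightarrow> j = P i \<longleftrightarrow> i = S j"
  by (auto simp: nxt_def prv_def)

text \<open>The form in which \<open>m \<ge> 6\<close> enters most table computations: a walk of one
  to five steps around the index circle does not close up.\<close>

lemma nxt_neq [simp]: "S i \<noteq> i" "S (S i) \<noteq> i" "S (S (S i)) \<noteq> i" "S (S (S (S i))) \<noteq> i" "S (S (S (S (S i)))) \<noteq> i"
   "i \<noteq> S i" "i \<noteq> S (S i)" "i \<noteq> S (S (S i))" "i \<noteq> S (S (S (S i)))" "i \<noteq> S (S (S (S (S i))))"
  if "i < m"
  using six that by (auto simp: nxt_def split: if_splits)

lemma third_commute: "T x y = T y x"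
  using six by (cases x; cases y) (auto simp: nxt_def split: if_splits)

section \<open>Regrouping a null quadric with a quadric of a given class\<close>

text \<open>If \<open>splits x y v\<close>, then \<open>x y\<close> times some quadric of the class of \<open>v\<close> is the product
  \<open>(x r)(y s)\<close> of two elements of the apolar ideal.\<close>

definition splits where "splits x y v \<longleftrightarrow> (\<exists>r\<in>V. \<exists>s\<in>V. T r s = Some v \<and> T x r = None \<and> T y s = None)"

lemma splitsI: "\<lbrakk>r \<in> V; s \<in> V; T r s = Some v; T x r = None \<and> T y s = None\<rbrakk> \<Longrightarrow> splits x y v"
  unfolding splits_def by blast

text \<open>The class of a_i consists of b_i c_i, a_{i+1}^2, a_{i-1} a_i and b_{i+1} d. The
  disjuncts distribute the two factors of each over \<open>x\<close> and \<open>y\<close> in both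
  orders.\<close>

lemma splits_A: "splits x y (VA i)" if "i < m"
  "(T x (VB i) = None \<and> T y (VC i) = None) \<or> (T y (VB i) = None \<and> T x (VC i) = None) \<or>
   (T x (VA (S i)) = None \<and> T y (VA (S i)) = None) \<or>
   (T x (VA (P i)) = None \<and> T y (VA i) = None) \<or> (T y (VA (P i)) = None \<and> T x (VA i) = None) \<or>
   (T x (VB (S i)) = None \<and> T y VD = None) \<or> (T y (VB (S i)) = None \<and> T x VD = None)"
  using that(2) splitsI[of "VB i" "VC i"] splitsI[of "VC i" "VB i"] splitsI[of "VA (S i)" "VA (S i)"]
     splitsI[of "VA (P i)" "VA i"] splitsI[of "VA i" "VA (P i)"] splitsI[of "VB (S i)" VD] splitsI[of VD "VB (S i)"] that(1)
  by (elim disjE) simp_all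

text \<open>The b-variables occur in the terms with d and in those with e, so this class has five
  quadrics where the other two letters have four.\<close>

lemma splits_B: "splits x y (VB i)" if "i < m"
  "(T x (VA i) = None \<and> T y (VC i) = None) \<or> (T y (VA i) = None \<and> T x (VC i) = None) \<or>
   (T x (VB (S i)) = None \<and> T y (VB (S i)) = None) \<or>
   (T x (VB (P i)) = None \<and> T y (VB i) = None) \<or> (T y (VB (P i)) = None \<and> T x (VB i) = None) \<or>
   (T x (VA (P i)) = None \<and> T y VD = None) \<or> (T y (VA (P i)) = None \<and> T x VD = None) \<or>
   (T x (VC (S i)) = None \<and> T y VE = None) \<or> (T y (VC (S i)) = None \<and> T x VE = None)"
  using that(2) splitsI[of "VA i" "VC i"] splitsI[of "VC i" "VA i"] splitsI[of "VB (S i)" "VB (S i)"]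
     splitsI[of "VB (P i)" "VB i"] splitsI[of "VB i" "VB (P i)"] splitsI[of "VA (P i)" VD] splitsI[of VD "VA (P i)"]
     splitsI[of "VC (S i)" VE] splitsI[of VE "VC (S i)"] that(1)
  by (elim disjE) simp_all

lemma splits_C: "splits x y (VC i)" if "i < m"
  "(T x (VA i) = None \<and> T y (VB i) = None) \<or> (T y (VA i) = None \<and> T x (VB i) = None) \<or>
   (T x (VC (S i)) = None \<and> T y (VC (S i)) = None) \<or>
   (T x (VC (P i)) = None \<and> T y (VC i) = None) \<or> (T y (VC (P i)) = None \<and> T x (VC i) = None) \<or>
   (T x (VB (P i)) = None \<and> T y VE = None) \<or> (T y (VB (P i)) = None \<and> T x VE = None)"
  using that(2) splitsI[of "VA i" "VB i"] splitsI[of "VB i" "VA i"] splitsI[of "VC (S i)" "VC (S i)"]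
     splitsI[of "VC (P i)" "VC i"] splitsI[of "VC i" "VC (P i)"] splitsI[of "VB (P i)" VE] splitsI[of VE "VB (P i)"] that(1)
  by (elim disjE) simp_all

text \<open>The quadrics in the class of a variable of index \<open>i\<close>, apart from d and e,
  have indices at distance at most 1 from \<open>i\<close>, and what meets them lies at distance at
  most 2. All further indices behave alike.\<close>

lemma var_cases:
  assumes "x \<in> V" "i < m"
  obtains "x = VA i" | "x = VA (S i)" | "x = VA (S (S i))" | "x = VA (P i)" | "x = VA (P (P i))"
    | j where "x = VA j" "j < m" "j \<noteq> i" "j \<noteq> S i" "j \<noteq> S (S i)" "j \<noteq> P i" "j \<noteq> P (P i)"
    | "x = VB i" | "x = VB (S i)" | "x = VB (S (S i))" | "x = VB (P i)" | "x = VB (P (P i))"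
    | j where "x = VB j" "j < m" "j \<noteq> i" "j \<noteq> S i" "j \<noteq> S (S i)" "j \<noteq> P i" "j \<noteq> P (P i)"
    | "x = VC i" | "x = VC (S i)" | "x = VC (S (S i))" | "x = VC (P i)" | "x = VC (P (P i))"
    | j where "x = VC j" "j < m" "j \<noteq> i" "j \<noteq> S i" "j \<noteq> S (S i)" "j \<noteq> P i" "j \<noteq> P (P i)"
    | "x = VD" | "x = VE"
  using assms(1) by (cases x) (simp_all del: prv_eq, metis+)

text \<open>The pairs \<open>x, y\<close> with \<open>third m x y = None\<close> for which \<open>splits\<close> fails at \<open>v\<close>, found by enumeration.\<close>

definition nonsplitA where "nonsplitA i = {(VA (P i), VB (S i)), (VA (S i), VB i), (VA (S (S i)), VB i), (VA (S i), VC i),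
  (VB i, VB (S (S i))), (VB (S i), VC i), (VC (S i), VD), (VD, VD), (VD, VE)}"
definition nonsplitB where "nonsplitB i = {(VA (P i), VB (S i)), (VA i, VC (S i)), (VB (P i), VC (S i))}"
definition nonsplitC where "nonsplitC i = {(VA (P i), VE), (VB (P i), VB (S i)), (VB (P i), VC (S i)), (VB i, VC (P i)),
  (VB (S i), VC (P i)), (VD, VE), (VE, VE)}"

text \<open>The class must differ from \<open>x\<close> and \<open>y\<close>: if
  \<open>T r s = Some y\<close>, rotation gives \<open>T y s = Some r\<close>, so
  \<open>T y s = None\<close> fails, and similarly for \<open>x\<close>.\<close>

lemma splits_or_nonsplit_A:
  assumes "x \<in> V" "y \<in> V" "i < m" "T x y = None" "VA i \<noteq> x" "VA i \<noteq> y"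
  shows "splits x y (VA i) \<or> (x, y) \<in> nonsplitA i \<or> (y, x) \<in> nonsplitA i"
proof (rule disjCI, rule splits_A[OF assms(3)])
  assume "\<not> ((x, y) \<in> nonsplitA i \<or> (y, x) \<in> nonsplitA i)"
  then show "(T x (VB i) = None \<and> T y (VC i) = None) \<or> (T y (VB i) = None \<and> T x (VC i) = None) \<or>
   (T x (VA (S i)) = None \<and> T y (VA (S i)) = None) \<or>
   (T x (VA (P i)) = None \<and> T y (VA i) = None) \<or> (T y (VA (P i)) = None \<and> T x (VA i) = None) \<or>
   (T x (VB (S i)) = None \<and> T y VD = None) \<or> (T y (VB (S i)) = None \<and> T x VD = None)"
    using assms(3-6)
    by (rule_tac var_cases[OF assms(1,3)]; rule_tac var_cases[OF assms(2,3)]; simp add: nonsplitA_def split: if_splits)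
qed

lemma splits_or_nonsplit_B:
  assumes "x \<in> V" "y \<in> V" "i < m" "T x y = None" "VB i \<noteq> x" "VB i \<noteq> y"
  shows "splits x y (VB i) \<or> (x, y) \<in> nonsplitB i \<or> (y, x) \<in> nonsplitB i"
proof (rule disjCI, rule splits_B[OF assms(3)])
  assume "\<not> ((x, y) \<in> nonsplitB i \<or> (y, x) \<in> nonsplitB i)"
  then show "(T x (VA i) = None \<and> T y (VC i) = None) \<or> (T y (VA i) = None \<and> T x (VC i) = None) \<or>
   (T x (VB (S i)) = None \<and> T y (VB (S i)) = None) \<or>
   (T x (VB (P i)) = None \<and> T y (VB i) = None) \<or> (T y (VB (P i)) = None \<and> T x (VB i) = None) \<or>
   (T x (VA (P i)) = None \<and> T y VD = None) \<or> (T y (VA (P i)) = None \<and> T x VD = None) \<or>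
   (T x (VC (S i)) = None \<and> T y VE = None) \<or> (T y (VC (S i)) = None \<and> T x VE = None)"
    using assms(3-6)
    by (rule_tac var_cases[OF assms(1,3)]; rule_tac var_cases[OF assms(2,3)]; simp add: nonsplitB_def split: if_splits)
qed

lemma splits_or_nonsplit_C:
  assumes "x \<in> V" "y \<in> V" "i < m" "T x y = None" "VC i \<noteq> x" "VC i \<noteq> y"
  shows "splits x y (VC i) \<or> (x, y) \<in> nonsplitC i \<or> (y, x) \<in> nonsplitC i"
proof (rule disjCI, rule splits_C[OF assms(3)])
  assume "\<not> ((x, y) \<in> nonsplitC i \<or> (y, x) \<in> nonsplitC i)"
  then show "(T x (VA i) = None \<and> T y (VB i) = None) \<or> (T y (VA i) = None \<and> T x (VB i) = None) \<or>
   (T x (VC (S i)) = None \<and> T y (VC (S i)) = None) \<or>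
   (T x (VC (P i)) = None \<and> T y (VC i) = None) \<or> (T y (VC (P i)) = None \<and> T x (VC i) = None) \<or>
   (T x (VB (P i)) = None \<and> T y VE = None) \<or> (T y (VB (P i)) = None \<and> T x VE = None)"
    using assms(3-6)
    by (rule_tac var_cases[OF assms(1,3)]; rule_tac var_cases[OF assms(2,3)]; simp add: nonsplitC_def split: if_splits)
qed

lemma ex_avoid:
  assumes "length xs \<le> 5"
  shows "\<exists>j<m. j \<notin> set xs"
proof (rule ccontr)
  assume "\<not> ?thesis"
  then have "{..<m} \<subseteq> set xs" by auto
  then have "card {..<m} \<le> card (set xs)" by (intro card_mono) auto
  also have "\<dots> \<le> length xs" by (rule card_length)
  finally show False using assms six by simp
qed

text \<open>For the classes of \<open>d\<close> and \<open>e\<close> a free index \<open>j\<close> has to be found. At most five indices are forbidden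
  by \<open>x\<close> and \<open>y\<close> once their roles are chosen well, so \<open>m \<ge> 6\<close> suffices.\<close>

lemma splits_D:
  assumes "x \<in> V" "y \<in> V" "T x y = None" "VD \<noteq> x" "VD \<noteq> y" "\<not> (x = VE \<and> y = VE)"
  shows "splits x y VD"
proof -
  let ?f = "\<lambda>x y. \<exists>j<m. T x (VA j) = None \<and> T y (VB (S j)) = None"
  have "splits x y VD" if "?f x y" for x y
    using that splitsI[of "VA j" "VB (S j)" for j] by auto
  moreover have "splits x y VD" if "?f y x"
    using that splitsI[of "VB (S j)" "VA j" for j] by auto
  moreover have "?f x y \<or> ?f y x"
  proof -
    have key: "?f x y \<or> ?f y x" if "length xs \<le> 5" "\<And>j. j < m \<Longrightarrow> j \<notin> set xs \<Longrightarrow>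
        T x (VA j) = None \<and> T y (VB (S j)) = None \<or> T y (VA j) = None \<and> T x (VB (S j)) = None" for xs
      using ex_avoid[OF that(1)] that(2) by blast
    show ?thesis
    proof (cases x)
      case (VA i)
      show ?thesis
      proof (cases y)
        case (VA k)
        then show ?thesis using \<open>x = VA i\<close> assms by (intro key[of "[i, S i, P i, P k, k]"]) (auto split: if_splits)
      next
        case (VB k)
        \<comment> \<open>Here the b-variable takes the factor \<open>VA j\<close>, which forbids 2
          + 2 indices. The opposite assignment can forbid 3 + 3, one more than
          \<open>ex_avoid\<close> admits.\<close>
        then show ?thesis using \<open>x = VA i\<close> assms by (intro key[of "[i, P i, k, P k]"]) (auto split: if_splits)
      next
        case (VC k)
        then show ?thesis using \<open>x = VA i\<close> assms by (intro key[of "[k, i, P i]"]) (auto split: if_splits)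
      next
        case VE
        then show ?thesis using \<open>x = VA i\<close> assms by (intro key[of "[i, P i]"]) (auto split: if_splits)
      qed (use assms in auto)
    next
      case (VB i)
      show ?thesis
      proof (cases y)
        case (VA k)
        then show ?thesis using \<open>x = VB i\<close> assms by (intro key[of "[i, P i, k, P k]"]) (auto split: if_splits)
      next
        case (VB k)
        then show ?thesis using \<open>x = VB i\<close> assms by (intro key[of "[i, P i, k, P k, P (P k)]"]) (auto split: if_splits)
      next
        case (VC k)
        then show ?thesis using \<open>x = VB i\<close> assms by (intro key[of "[i, P i, P k, P (P k)]"]) (auto split: if_splits)
      next
        case VE
        then show ?thesis using \<open>x = VB i\<close> assms by (intro key[of "[i, P i, P (P i)]"]) (auto split: if_splits)
      qed (use assms in auto)
    next
      case (VC i)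
      show ?thesis
      proof (cases y)
        case (VA k)
        then show ?thesis using \<open>x = VC i\<close> assms by (intro key[of "[i, k, P k]"]) (auto split: if_splits)
      next
        case (VB k)
        then show ?thesis using \<open>x = VC i\<close> assms by (intro key[of "[i, k, P k, P (P k)]"]) (auto split: if_splits)
      next
        case (VC k)
        then show ?thesis using \<open>x = VC i\<close> assms by (intro key[of "[i, P k, P (P k)]"]) (auto split: if_splits)
      next
        case VE
        then show ?thesis using \<open>x = VC i\<close> assms by (intro key[of "[P i, P (P i)]"]) (auto split: if_splits)
      qed (use assms in auto)
    next
      case VE
      then show ?thesis
            proof (cases y)
        case (VA k)
        then show ?thesis using VE assms by (intro key[of "[k, P k]"]) (auto split: if_splits)
      next
        case (VB k)
        then show ?thesis using VE assms by (intro key[of "[k, P k, P (P k)]"]) (auto split: if_splits)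
      next
        case (VC k)
        then show ?thesis using VE assms by (intro key[of "[P k, P (P k)]"]) (auto split: if_splits)
      qed (use assms in auto)
    qed (use assms in auto)
  qed
  ultimately show ?thesis by blast
qed
lemma splits_E:
  assumes "x \<in> V" "y \<in> V" "T x y = None" "VE \<noteq> x" "VE \<noteq> y" "\<not> (x = VD \<and> y = VD)"
  shows "splits x y VE"
proof -
  let ?f = "\<lambda>x y. \<exists>j<m. T x (VB j) = None \<and> T y (VC (S j)) = None"
  have "splits x y VE" if "?f x y" for x y
    using that splitsI[of "VB j" "VC (S j)" for j] by auto
  moreover have "splits x y VE" if "?f y x"
    using that splitsI[of "VC (S j)" "VB j" for j] by auto
  moreover have "?f x y \<or> ?f y x"
  proof -
    have key: "?f x y \<or> ?f y x" if "length xs \<le> 5" "\<And>j. j < m \<Longrightarrow> j \<notin> set xs \<Longrightarrow>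
        T x (VB j) = None \<and> T y (VC (S j)) = None \<or> T y (VB j) = None \<and> T x (VC (S j)) = None" for xs
      using ex_avoid[OF that(1)] that(2) by blast
    show ?thesis
    proof (cases x)
      case (VA i)
      note x = this
      show ?thesis
      proof (cases y)
        case (VA k)
        then show ?thesis using x assms by (intro key[of "[i, S i, P k]"]) (auto split: if_splits)
      next
        case (VB k)
        then show ?thesis using x assms by (intro key[of "[i, S i, k, P k]"]) (auto split: if_splits)
      next
        case (VC k)
        then show ?thesis using x assms by (intro key[of "[i, S i, k, P k, P (P k)]"]) (auto split: if_splits)
      next
        case VD
        then show ?thesis using x assms by (intro key[of "[P i]"]) (auto split: if_splits)
      qed (use x assms in auto)
    next
      case (VB i)
      note x = this
      show ?thesis
      proof (cases y)
        case (VA k)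
        then show ?thesis using x assms by (intro key[of "[k, S k, i, P i]"]) (auto split: if_splits)
      next
        case (VB k)
        then show ?thesis using x assms by (intro key[of "[i, S i, P i, k, P k]"]) (auto split: if_splits)
      next
        case (VC k)
        then show ?thesis using x assms by (intro key[of "[k, P k, i, P i]"]) (auto split: if_splits)
      next
        case VD
        then show ?thesis using x assms by (intro key[of "[i, P i]"]) (auto split: if_splits)
      qed (use x assms in auto)
    next
      case (VC i)
      note x = this
      show ?thesis
      proof (cases y)
        case (VA k)
        then show ?thesis using x assms by (intro key[of "[k, S k, i, P i, P (P i)]"]) (auto split: if_splits)
      next
        case (VB k)
        then show ?thesis using x assms by (intro key[of "[i, P i, k, P k]"]) (auto split: if_splits)
      next
        case (VC k)
        then show ?thesis using x assms by (intro key[of "[i, P i, k, P k, P (P k)]"]) (auto split: if_splits)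
      next
        case VD
        then show ?thesis using x assms by (intro key[of "[i, P i, P (P i)]"]) (auto split: if_splits)
      qed (use x assms in auto)
    next
      case VD
      note x = this
      show ?thesis
      proof (cases y)
        case (VA k)
        then show ?thesis using x assms by (intro key[of "[P k]"]) (auto split: if_splits)
      next
        case (VB k)
        then show ?thesis using x assms by (intro key[of "[k, P k]"]) (auto split: if_splits)
      next
        case (VC k)
        then show ?thesis using x assms by (intro key[of "[k, P k, P (P k)]"]) (auto split: if_splits)
      qed (use x assms in auto)
    qed (use assms in auto)
  qed
  ultimately show ?thesis by blast
qed

lemma zero_less [simp]: "0 < m"
  using six by simp

lemma third_mem: "\<lbrakk>T x y = Some z; x \<in> V; y \<in> V\<rbrakk> \<Longrightarrow> z \<in> V"
  by (cases x; cases y; simp split: if_splits; safe) simp_all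

text \<open>Together with \<open>third_commute\<close> this makes \<open>T x y = Some z\<close>
  symmetric in all three variables, as it should be for a relation saying that \<open>x y z\<close>
  is a term.\<close>

lemma third_rotate: "\<lbrakk>T x y = Some z; x \<in> V; y \<in> V\<rbrakk> \<Longrightarrow> T y z = Some x"
  by (cases x; cases y; simp split: if_splits; safe) simp_all

end

section \<open>Quartic monomials modulo the square of the apolar ideal\<close>

text \<open>The quartics \<open>v t\<close> that are dual to the functionals \<open>v\<^sup>* F\<close>.\<close>

fun hub :: "nat \<Rightarrow> cubic_var \<Rightarrow> cubic_var multiset" where
  "hub m (VA i) = {#VA i, VE, VB 0, VC (nxt m 0)#}"
| "hub m (VB i) = {#VB i, VD, VA (nxt m (nxt m i)), VB (nxt m (nxt m (nxt m i)))#}"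
| "hub m (VC i) = {#VC i, VD, VA 0, VB (nxt m 0)#}"
| "hub m VD = {#VD, VE, VB 0, VC (nxt m 0)#}"
| "hub m VE = {#VE, VD, VA 0, VB (nxt m 0)#}"

text \<open>\<open>Z M\<close> stands for membership of the monomial \<open>M\<close> in the span of \<open>I\<^sup>2\<close> and the hubs. The first three rules
  come from \<open>(q - q')(r - r')\<close>, \<open>q(r - r')\<close> and \<open>q r\<close> in \<open>I\<^sup>2\<close>.\<close>

locale quartic_closure = cubic_indices m for m :: nat +
  fixes Z :: "cubic_var multiset \<Rightarrow> bool"
  assumes swap: "\<lbrakk>{x, y, z, w, x', y', z', w'} \<subseteq> cubic_vars m;
      third m x y = third m x' y'; third m z w = third m z' w';
      Z {#x, y, z', w'#}; Z {#x', y', z, w#}; Z {#x', y', z', w'#}\<rbrakk> \<Longrightarrow> Z {#x, y, z, w#}"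
    and null_swap: "\<lbrakk>{x, y, z, w, z', w'} \<subseteq> cubic_vars m;
      third m x y = None; third m z w = third m z' w'; Z {#x, y, z', w'#}\<rbrakk> \<Longrightarrow> Z {#x, y, z, w#}"
    and null_null: "\<lbrakk>{x, y, z, w} \<subseteq> cubic_vars m;
      third m x y = None; third m z w = None\<rbrakk> \<Longrightarrow> Z {#x, y, z, w#}"
    and Z_hub: "v \<in> cubic_vars m \<Longrightarrow> Z (hub m v)"
begin

section \<open>A null quadric times a whole class\<close>

definition reduced where "reduced x y v \<longleftrightarrow> (\<forall>z\<in>V. \<forall>w\<in>V. T z w = Some v \<longrightarrow> Z {#x, y, z, w#})"

text \<open>Next to a null quadric, \<open>null_swap\<close> makes all quadrics of one class
  interchangeable, so a single representative decides the class.\<close>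

lemma reducedI:
  "\<lbrakk>{x, y, r, s} \<subseteq> V; T x y = None; T r s = Some v; Z {#x, y, r, s#}\<rbrakk> \<Longrightarrow> reduced x y v"
  unfolding reduced_def by (intro ballI impI, rule null_swap[of x y _ _ r s]) auto

lemma reducedD: "\<lbrakk>reduced x y v; T z w = Some v; z \<in> V; w \<in> V\<rbrakk> \<Longrightarrow> Z {#x, y, z, w#}"
  unfolding reduced_def by blast

lemma reduced_commute: "reduced x y v \<longleftrightarrow> reduced y x v"
  by (simp add: reduced_def add_mset_commute[of x])

lemma splits_imp_reduced:
  assumes "splits x y v" "x \<in> V" "y \<in> V" "T x y = None"
  shows "reduced x y v"
proof -
  obtain r s where rs: "r \<in> V" "s \<in> V" "T r s = Some v" "T x r = None" "T y s = None"
    using assms(1) unfolding splits_def by blast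
  then have "Z {#x, r, y, s#}"
    using assms by (intro null_null) simp_all
  then show ?thesis
    using rs assms by (intro reducedI[of x y r s]) (simp_all add: add_mset_commute)
qed

text \<open>Regrouping as \<open>(x r)(y s)\<close> with only \<open>x r\<close> null does not
  finish, but it moves the question to the null quadric \<open>x r\<close> and the class
  \<open>u\<close> of \<open>y s\<close>. The exceptional pairs are settled by such moves.\<close>

lemma reduced_step:
  assumes "{x, y, r, s} \<subseteq> V" "T x y = None" "T r s = Some v" "T x r = None" "T y s = Some u" "reduced x r u"
  shows "reduced x y v"
proof -
  have "Z {#x, r, y, s#}"
    using assms by (intro reducedD[of x r u]) simp_all
  then show ?thesis
    using assms by (intro reducedI[of x y r s]) (simp_all add: add_mset_commute)
qed

lemma reduced_D: "\<lbrakk>x \<in> V; y \<in> V; T x y = None; VD \<noteq> x; VD \<noteq> y; \<not> (x = VE \<and> y = VE)\<rbrakk> \<Longrightarrow> reduced x y VD"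
  by (simp add: splits_imp_reduced splits_D)

lemma reduced_E: "\<lbrakk>x \<in> V; y \<in> V; T x y = None; VE \<noteq> x; VE \<noteq> y; \<not> (x = VD \<and> y = VD)\<rbrakk> \<Longrightarrow> reduced x y VE"
  by (simp add: splits_imp_reduced splits_E)

lemma reduced_A: "\<lbrakk>x \<in> V; y \<in> V; i < m; T x y = None; VA i \<noteq> x; VA i \<noteq> y; (x, y) \<notin> nonsplitA i; (y, x) \<notin> nonsplitA i\<rbrakk> \<Longrightarrow> reduced x y (VA i)"
  using splits_or_nonsplit_A[of x y i] by (blast intro: splits_imp_reduced)

lemma reduced_B: "\<lbrakk>x \<in> V; y \<in> V; i < m; T x y = None; VB i \<noteq> x; VB i \<noteq> y; (x, y) \<notin> nonsplitB i; (y, x) \<notin> nonsplitB i\<rbrakk> \<Longrightarrow> reduced x y (VB i)"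
  using splits_or_nonsplit_B[of x y i] by (blast intro: splits_imp_reduced)

lemma reduced_C: "\<lbrakk>x \<in> V; y \<in> V; i < m; T x y = None; VC i \<noteq> x; VC i \<noteq> y; (x, y) \<notin> nonsplitC i; (y, x) \<notin> nonsplitC i\<rbrakk> \<Longrightarrow> reduced x y (VC i)"
  using splits_or_nonsplit_C[of x y i] by (blast intro: splits_imp_reduced)

lemma reduced_nonsplitA:
  assumes i: "i < m" and xy: "(x, y) \<in> nonsplitA i"
  shows "reduced x y (VA i)"
proof -
  \<comment> \<open>Stated for all indices, because the pair \<open>VD\<close>, \<open>VD\<close>
    below needs it one index lower.\<close>
  have CD: "reduced (VC (S i)) VD (VA i)" if "i < m" for i
    by (rule reduced_step[of _ _ "VA (P i)" "VA i" _ "VB (S i)"]; (rule reduced_B)?; use that in \<open>auto simp: nonsplitB_def\<close>)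
  have DC: "reduced VD (VC i) (VA (P i))"
    using CD[of "P i"] i by (simp add: reduced_commute)
  have "reduced VD VD (VA i)"
    by (rule reduced_step[of _ _ "VC i" "VB i" _ "VA (P i)"]; use i DC in simp)
  moreover have "reduced (VA (P i)) (VB (S i)) (VA i)"
    by (rule reduced_step[of _ _ "VA (S i)" "VA (S i)" _ "VC (S i)"]; (rule reduced_C)?; use i in \<open>auto simp: nonsplitC_def\<close>)
  moreover have "reduced (VA (S i)) (VB i) (VA i)"
    by (rule reduced_step[of _ _ "VA (P i)" "VA i" _ "VC i"]; (rule reduced_C)?; use i in \<open>auto simp: nonsplitC_def\<close>)
  moreover have "reduced (VA (S (S i))) (VB i) (VA i)"
    by (rule reduced_step[of _ _ "VA (P i)" "VA i" _ "VC i"]; (rule reduced_C)?; use i in \<open>auto simp: nonsplitC_def\<close>)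
  moreover have "reduced (VA (S i)) (VC i) (VA i)"
    by (rule reduced_step[of _ _ "VA (P i)" "VA i" _ "VB i"]; (rule reduced_B)?; use i in \<open>auto simp: nonsplitB_def\<close>)
  moreover have "reduced (VB (S (S i))) (VB i) (VA i)"
    by (rule reduced_step[of _ _ "VA (P i)" "VA i" _ "VC i"]; (rule reduced_C)?; use i in \<open>auto simp: nonsplitC_def\<close>)
  moreover have "reduced (VC i) (VB (S i)) (VA i)"
    by (rule reduced_step[of _ _ "VA (P i)" "VA i" _ VD]; (rule reduced_D)?; use i in auto)
  moreover have "reduced VE VD (VA i)"
    by (rule reduced_step[of _ _ "VA (P i)" "VA i" _ "VB (S i)"]; (rule reduced_B)?; use i in \<open>auto simp: nonsplitB_def\<close>)
  ultimately show ?thesis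
    using CD[OF i] xy by (auto simp: nonsplitA_def reduced_commute)
qed

lemma reduced_nonsplitB:
  assumes i: "i < m" and xy: "(x, y) \<in> nonsplitB i"
  shows "reduced x y (VB i)"
proof -
  have "reduced (VA (P i)) (VB (S i)) (VB i)"
    by (rule reduced_step[of _ _ "VC i" "VA i" _ VD]; (rule reduced_D)?; use i in auto)
  moreover have "reduced (VA i) (VC (S i)) (VB i)"
    by (rule reduced_step[of _ _ "VB (P i)" "VB i" _ VE]; (rule reduced_E)?; use i in auto)
  moreover have "reduced (VB (P i)) (VC (S i)) (VB i)"
    by (rule reduced_step[of _ _ "VA i" "VC i" _ "VC (S i)"]; (rule reduced_C)?; use i in \<open>auto simp: nonsplitC_def\<close>)
  ultimately show ?thesis
    using xy by (auto simp: nonsplitB_def)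
qed

lemma reduced_nonsplitC:
  assumes i: "i < m" and xy: "(x, y) \<in> nonsplitC i"
  shows "reduced x y (VC i)"
proof -
  have EA: "reduced VE (VA (P i)) (VC i)" if "i < m" for i
    by (rule reduced_step[of _ _ "VA i" "VB i" _ VD]; (rule reduced_D)?; use that in auto)
  have EA': "reduced VE (VA i) (VC (S i))"
    using EA[of "S i"] i by simp
  have "reduced VE VE (VC i)"
    by (rule reduced_step[of _ _ "VA i" "VB i" _ "VC (S i)"]; use i EA' in simp)
  moreover have "reduced (VB (P i)) (VB (S i)) (VC i)"
    by (rule reduced_step[of _ _ "VA i" "VB i" _ "VB (S i)"]; (rule reduced_B)?; use i in \<open>auto simp: nonsplitB_def\<close>)
  moreover have "reduced (VB (P i)) (VC (S i)) (VC i)"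
    by (rule reduced_step[of _ _ "VA i" "VB i" _ VE]; (rule reduced_E)?; use i in auto)
  moreover have "reduced (VC (P i)) (VB i) (VC i)"
    by (rule reduced_step[of _ _ "VA i" "VB i" _ "VB (P i)"]; (rule reduced_B)?; use i in \<open>auto simp: nonsplitB_def\<close>)
  moreover have "reduced (VC (P i)) (VB (S i)) (VC i)"
    by (rule reduced_step[of _ _ "VA i" "VB i" _ "VB (S i)"]; (rule reduced_B)?; use i in \<open>auto simp: nonsplitB_def\<close>)
  moreover have "reduced VD VE (VC i)"
    by (rule reduced_step[of _ _ "VC i" "VC (P i)" _ "VB (P (P i))"]; (rule reduced_B)?; use i in \<open>auto simp: nonsplitB_def\<close>)
  ultimately show ?thesis
    using EA[OF i] xy by (auto simp: nonsplitC_def reduced_commute)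
qed

lemma reduced_other:
  assumes "x \<in> V" "y \<in> V" "v \<in> V" "T x y = None" "v \<noteq> x" "v \<noteq> y"
  shows "reduced x y v"
proof (cases v)
  case (VA i)
  then show ?thesis
    using assms reduced_A[of x y i] reduced_nonsplitA[of i x y] reduced_nonsplitA[of i y x] by (auto simp: reduced_commute)
next
  case (VB i)
  then show ?thesis
    using assms reduced_B[of x y i] reduced_nonsplitB[of i x y] reduced_nonsplitB[of i y x] by (auto simp: reduced_commute)
next
  case (VC i)
  then show ?thesis
    using assms reduced_C[of x y i] reduced_nonsplitC[of i x y] reduced_nonsplitC[of i y x] by (auto simp: reduced_commute)
next
  case VD
  \<comment> \<open>The pair excluded in \<open>splits_D\<close>: \<open>VE\<close> is non-null with
    every \<open>VB (S j)\<close>. One regrouping leads to \<open>VE\<close>, \<open>VA 0\<close>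
    and the class of c_2, which is not exceptional.\<close>
  have "reduced VE VE VD"
    by (rule reduced_step[of _ _ "VA 0" "VB (S 0)" _ "VC (S (S 0))"]; (rule reduced_C)?) (auto simp: nonsplitC_def)
  then show ?thesis
    using VD assms reduced_D[of x y] by auto
next
  case VE
  have "reduced VD VD VE"
    by (rule reduced_step[of _ _ "VC (S 0)" "VB 0" _ "VA (P 0)"]; (rule reduced_A)?) (auto simp: nonsplitA_def)
  then show ?thesis
    using VE assms reduced_E[of x y] by auto
qed

section \<open>Null quadrics times the class of one of their own factors\<close>

text \<open>The monomial \<open>x y z w\<close> is both \<open>x y\<close> times a quadric of the class of \<open>y\<close> and \<open>x z\<close> times a quadric of the
  class of \<open>z\<close>. Walking along the terms of the cubic, all quartics \<open>x t\<close> reduce to the hub of \<open>x\<close>.\<close>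

lemma reduced_link:
  assumes "{x, y, z, w} \<subseteq> V" "T x y = None" "T x z = None" "T z w = Some y" "reduced x y y"
  shows "reduced x z z"
proof -
  have "T y w = Some z"
    using third_rotate[OF assms(4)] third_commute[of w y] assms(1) by simp
  moreover have "Z {#x, z, y, w#}"
    using reducedD[OF assms(5,4)] assms(1) by (simp add: add_mset_commute)
  ultimately show ?thesis
    using assms by (intro reducedI[of x z y w]) simp_all
qed

text \<open>The hub settles the class of e, which is null with every a-variable. The terms b_j
  c_{j+1} e link it to the admissible b- and c-variables, and the terms a_j b_j c_j lead on to the
  admissible a-variables.\<close>

lemma reduced_self_A:
  assumes i: "i < m" and y: "y \<in> V" "T (VA i) y = None"
  shows "reduced (VA i) y y"
proof -
  have E: "reduced (VA i) VE VE"
    by (rule reducedI[of _ _ "VB 0" "VC (S 0)"]) (use i Z_hub[of "VA i"] in simp_all)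
  have C: "reduced (VA i) (VC j) (VC j)" if "j < m" "j \<noteq> i" for j
    by (rule reduced_link[of _ VE _ "VB (P j)"]; use i that E in simp)
  have "reduced (VA i) (VB j) (VB j)" if "j < m" "j \<noteq> i" "j \<noteq> S i" for j
    by (rule reduced_link[of _ VE _ "VC (S j)"]; use i that E in simp)
  moreover have "reduced (VA i) (VA j) (VA j)" if "j < m" "j \<noteq> i" "j \<noteq> S i" "i \<noteq> S j" for j
    by (rule reduced_link[of _ "VC j" _ "VB j"]; use i that C in simp)
  ultimately show ?thesis
    using i y E C by (cases y) (auto split: if_splits)
qed

lemma reduced_self_C:
  assumes i: "i < m" and y: "y \<in> V" "T (VC i) y = None"
  shows "reduced (VC i) y y"
proof -
  have D: "reduced (VC i) VD VD"
    by (rule reducedI[of _ _ "VA 0" "VB (S 0)"]) (use i Z_hub[of "VC i"] in simp_all)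
  have A: "reduced (VC i) (VA j) (VA j)" if "j < m" "j \<noteq> i" for j
    by (rule reduced_link[of _ VD _ "VB (S j)"]; use i that D in simp)
  have "reduced (VC i) (VB j) (VB j)" if "j < m" "j \<noteq> i" "i \<noteq> S j" for j
    by (rule reduced_link[of _ VD _ "VA (P j)"]; use i that D in simp)
  moreover have "reduced (VC i) (VC j) (VC j)" if "j < m" "j \<noteq> i" "j \<noteq> S i" "i \<noteq> S j" for j
    by (rule reduced_link[of _ "VA j" _ "VB j"]; use i that A in simp)
  ultimately show ?thesis
    using i y D A by (cases y) (auto split: if_splits)
qed

text \<open>Neither d nor e is null with b_i, so the walk cannot pass through them. The hub settles
  only the class of a_{i+2}; a swap carries this to the other a_j that are far from
  \<open>i\<close>, and links do the rest.\<close>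

lemma reduced_self_B:
  assumes i: "i < m" and y: "y \<in> V" "T (VB i) y = None"
  shows "reduced (VB i) y y"
proof -
  have A1: "reduced (VB i) (VA j) (VA j)" if j: "j < m" "j \<noteq> i" "j \<noteq> S i" "i \<noteq> S j" for j
  proof -
    have "Z {#VB i, VD, VA j, VB (S j)#}"
    \<comment> \<open>Both \<open>VB i VD\<close> and \<open>VA i VA i\<close> have class
      \<open>VA (P i)\<close>. The square is useful because its two copies of \<open>VA i\<close>
      are null with both factors of either quadric of class d.\<close>
    proof (rule swap[of _ _ _ _ "VA i" "VA i" "VA (S (S i))" "VB (S (S (S i)))"])
      show "Z {#VB i, VD, VA (S (S i)), VB (S (S (S i)))#}"
        using Z_hub[of "VB i"] i by simp
      show "Z {#VA i, VA i, VA j, VB (S j)#}"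
        using null_null[of "VA i" "VA j" "VA i" "VB (S j)"] i j by (simp add: add_mset_commute)
      show "Z {#VA i, VA i, VA (S (S i)), VB (S (S (S i)))#}"
        using null_null[of "VA i" "VA (S (S i))" "VA i" "VB (S (S (S i)))"] i by (simp add: add_mset_commute)
    qed (use i j in simp_all)
    then show ?thesis
      by (intro reducedI[of _ _ VD "VB (S j)"]) (use i j in \<open>simp_all add: add_mset_commute\<close>)
  qed
  moreover have "reduced (VB i) (VA (S i)) (VA (S i))"
    by (rule reduced_link[of _ "VA (S (S i))" _ "VA (S (S i))"]; use i A1 in simp)
  ultimately have A: "reduced (VB i) (VA j) (VA j)" if "j < m" "j \<noteq> i" "i \<noteq> S j" for j
    using that by metis
  have C1: "reduced (VB i) (VC j) (VC j)" if "j < m" "j \<noteq> i" "j \<noteq> S i" "i \<noteq> S j" for j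
    by (rule reduced_link[of _ "VA j" _ "VB j"]; use i that A in simp)
  moreover have "reduced (VB i) (VC (P i)) (VC (P i))"
    by (rule reduced_link[of _ "VC (P (P i))" _ "VC (P i)"]; use i C1 in simp)
  ultimately have C: "reduced (VB i) (VC j) (VC j)" if "j < m" "j \<noteq> i" "j \<noteq> S i" for j
    using that by (metis prv_nxt)
  have "reduced (VB i) (VB j) (VB j)" if "j < m" "j \<noteq> i" "j \<noteq> S i" "i \<noteq> S j" for j
    by (rule reduced_link[of _ "VC j" _ "VA j"]; use i that C in simp)
  then show ?thesis
    using i y A C by (cases y) (auto split: if_splits)
qed

lemma
  shows reduced_self_D: "y \<in> V \<Longrightarrow> T VD y = None \<Longrightarrow> y \<noteq> VD \<Longrightarrow> reduced VD y y"
    and reduced_self_E: "y \<in> V \<Longrightarrow> T VE y = None \<Longrightarrow> y \<noteq> VE \<Longrightarrow> reduced VE y y"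
proof -
  have D: "reduced VD VE VE"
    by (rule reducedI[of _ _ "VB 0" "VC (S 0)"]) (use Z_hub[of VD] in simp_all)
  have "reduced VD (VC j) (VC j)" if "j < m" for j
    by (rule reduced_link[of _ VE _ "VB (P j)"]; use that D in simp)
  then show "reduced VD y y" if "y \<in> V" "T VD y = None" "y \<noteq> VD"
    using D that by (cases y) auto
  have E: "reduced VE VD VD"
    by (rule reducedI[of _ _ "VA 0" "VB (S 0)"]) (use Z_hub[of VE] in simp_all)
  have "reduced VE (VA j) (VA j)" if "j < m" for j
    by (rule reduced_link[of _ VD _ "VB (S j)"]; use that E in simp)
  then show "reduced VE y y" if "y \<in> V" "T VE y = None" "y \<noteq> VE"
    using E that by (cases y) auto
qed

lemma reduced_self:
  assumes "x \<in> V" "y \<in> V" "T x y = None" "x \<noteq> y"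
  shows "reduced x y y"
  using assms reduced_self_A reduced_self_B reduced_self_C reduced_self_D reduced_self_E by (cases x) auto

lemma reduced_neq:
  assumes "x \<in> V" "y \<in> V" "v \<in> V" "T x y = None" "x \<noteq> y"
  shows "reduced x y v"
  using assms reduced_other[of x y v] reduced_self[of x y] reduced_self[of y x] reduced_commute[of y x] third_commute[of y x] by metis

text \<open>The variable d has multiplicity 2 in this quartic, so its value under
  \<open>deriv_coeff VD\<close> is 2. Accordingly the swap has two mixed products that are each
  congruent to the hub of \<open>VD\<close> modulo \<open>I2\<close>, while the third product
  vanishes there.\<close>

lemma reduced_DD: "reduced VD VD VD"
proof -
  have "Z {#VD, VA 0, VD, VB (S 0)#}"
  proof (rule swap[of _ _ _ _ "VC (S (S 0))" VE "VB 0" "VC 0"])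
    show "Z {#VD, VA 0, VB 0, VC 0#}"
      using reducedD[OF reduced_neq[of VD "VC 0" "VC 0"], of "VA 0" "VB 0"] by (simp add: add_mset_commute)
    show "Z {#VC (S (S 0)), VE, VD, VB (S 0)#}"
      using reducedD[OF reduced_neq[of VD VE VE], of "VC (S (S 0))" "VB (S 0)"] by (simp add: add_mset_commute)
    show "Z {#VC (S (S 0)), VE, VB 0, VC 0#}"
      using reducedD[OF reduced_neq[of "VC (S (S 0))" "VC 0" "VC (S 0)"], of VE "VB 0"] by (simp add: add_mset_commute)
  qed simp_all
  then show ?thesis
    by (intro reducedI[of _ _ "VA 0" "VB (S 0)"]) (simp_all add: add_mset_commute)
qed

lemma reduced_EE: "reduced VE VE VE"
proof -
  have "Z {#VE, VB 0, VE, VC (S 0)#}"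
  proof (rule swap[of _ _ _ _ "VA (S 0)" "VB (S 0)" "VA (P 0)" VD])
    show "Z {#VE, VB 0, VA (P 0), VD#}"
      using reducedD[OF reduced_neq[of VE VD VD], of "VB 0" "VA (P 0)"] by (simp add: add_mset_commute)
    show "Z {#VA (S 0), VB (S 0), VE, VC (S 0)#}"
      using reducedD[OF reduced_neq[of VE "VA (S 0)" "VA (S 0)"], of "VB (S 0)" "VC (S 0)"] by (simp add: add_mset_commute)
    show "Z {#VA (S 0), VB (S 0), VA (P 0), VD#}"
      using reducedD[OF reduced_neq[of "VA (S 0)" "VA (P 0)" "VA 0"], of "VB (S 0)" VD] by (simp add: add_mset_commute)
  qed simp_all
  then show ?thesis
    by (intro reducedI[of _ _ "VB 0" "VC (S 0)"]) (simp_all add: add_mset_commute)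
qed

lemma reduced_all:
  assumes "x \<in> V" "y \<in> V" "v \<in> V" "T x y = None"
  shows "reduced x y v"
proof (cases "x = y")
  case True
  then have "x = VD \<or> x = VE"
    using assms by (cases x) (auto split: if_splits)
  then show ?thesis
    using True assms reduced_other[of x x v] reduced_DD reduced_EE by auto
qed (use assms reduced_neq in blast)

lemma Z_null:
  assumes "{x, y, z, w} \<subseteq> V" "T x y = None"
  shows "Z {#x, y, z, w#}"
proof (cases "T z w")
  case None
  then show ?thesis using assms null_null by simp
next
  case (Some v)
  then show ?thesis
    using assms third_mem[of z w v] reduced_all[of x y v] reducedD[of x y v z w] by simp
qed

section \<open>Quartics in which every pair of variables divides a term\<close>

definition has_null_pair where "has_null_pair x y z w \<longleftrightarrow> T x y = None \<or> T x z = None \<or> T x w = None \<or>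
  T y z = None \<or> T y w = None \<or> T z w = None"

lemma Z_has_null_pair:
  assumes "{x, y, z, w} \<subseteq> V" "has_null_pair x y z w"
  shows "Z {#x, y, z, w#}"
  using assms(2) unfolding has_null_pair_def
proof (elim disjE)
qed (use assms(1) Z_null[of x y z w] Z_null[of x z y w] Z_null[of x w y z] Z_null[of y z x w]
    Z_null[of y w x z] Z_null[of z w x y] in \<open>simp_all add: add_mset_commute\<close>)

text \<open>A single replacement of both quadrics suffices once each of the three other products has
  a null pair, which is a mere lookup in the table.\<close>

lemma Z_swap:
  assumes "{x, y, z, w, p, q, r, s} \<subseteq> V" "T x y = T p q" "T z w = T r s"
    "has_null_pair x y r s" "has_null_pair p q z w" "has_null_pair p q r s"
  shows "Z {#x, y, z, w#}"
  by (rule swap[of x y z w p q r s]) (use assms in \<open>simp_all add: Z_has_null_pair\<close>)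

text \<open>Class d contains a_k b_{k+1} for every k. With k = i + 3, every variable other than d
  that is non-null with both a_i and b_{i+1} is null with a_k. Since d^2 is null, at most one of
  \<open>z\<close> and \<open>w\<close> is d, so the other supplies a null pair.\<close>

lemma Z_AB:
  assumes i: "i < m" and zw: "{z, w} \<subseteq> V"
  shows "Z {#VA i, VB (S i), z, w#}"
proof (cases "has_null_pair (VA i) (VB (S i)) z w")
  case True
  then show ?thesis using i zw by (intro Z_has_null_pair) simp_all
next
  case False
  let ?k = "S (S (S i))"
  have *: "T z w \<noteq> None" "T (VA i) z \<noteq> None" "T (VB (S i)) z \<noteq> None" "T (VA i) w \<noteq> None" "T (VB (S i)) w \<noteq> None"
    using False unfolding has_null_pair_def by auto
  have distant: "T (VA ?k) v = None" if "v \<in> V" "v \<noteq> VD" "T (VA i) v \<noteq> None" "T (VB (S i)) v \<noteq> None" for v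
    using that i by (cases v) (auto split: if_splits)
  have "z \<noteq> VD \<or> w \<noteq> VD" using * by auto
  then have n: "has_null_pair z w (VA ?k) (VB (S ?k))" "has_null_pair (VA ?k) (VB (S ?k)) z w"
    using distant[of z] distant[of w] * zw unfolding has_null_pair_def by (auto simp: third_commute)
  obtain u where u: "T z w = Some u" using * by blast
  then have "u \<in> V" using third_mem[of z w u] zw by simp
  show ?thesis
  proof (cases u)
    case (VA k)
    show ?thesis
      by (rule Z_swap[of _ _ _ _ "VA ?k" "VB (S ?k)" "VB k" "VC k"])
        (use i zw u n VA \<open>u \<in> V\<close> in \<open>auto simp: has_null_pair_def\<close>)
  next
    case (VB k)
    show ?thesis
      by (rule Z_swap[of _ _ _ _ "VA ?k" "VB (S ?k)" "VA k" "VC k"])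
        (use i zw u n VB \<open>u \<in> V\<close> in \<open>auto simp: has_null_pair_def\<close>)
  next
    case (VC k)
    show ?thesis
      by (rule Z_swap[of _ _ _ _ "VA ?k" "VB (S ?k)" "VC (P k)" "VC k"])
        (use i zw u n VC \<open>u \<in> V\<close> in \<open>auto simp: has_null_pair_def\<close>)
  next
    case VD
    show ?thesis
      by (rule Z_swap[of _ _ _ _ "VA ?k" "VB (S ?k)" "VA (S (S i))" "VB ?k"])
        (use i zw u n VD in \<open>auto simp: has_null_pair_def\<close>)
  next
    case VE
    show ?thesis
      by (rule Z_swap[of _ _ _ _ "VA ?k" "VB (S ?k)" "VB ?k" "VC (S ?k)"])
        (use i zw u n VE in \<open>auto simp: has_null_pair_def\<close>)
  qed
qed

lemma Z_BC:
  assumes i: "i < m" and zw: "{z, w} \<subseteq> V"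
  shows "Z {#VB i, VC (S i), z, w#}"
proof (cases "has_null_pair (VB i) (VC (S i)) z w")
  case True
  then show ?thesis using i zw by (intro Z_has_null_pair) simp_all
next
  case False
  let ?k = "S (S (S i))"
  have *: "T z w \<noteq> None" "T (VB i) z \<noteq> None" "T (VC (S i)) z \<noteq> None" "T (VB i) w \<noteq> None" "T (VC (S i)) w \<noteq> None"
    using False unfolding has_null_pair_def by auto
  have distant: "T (VC (S ?k)) v = None" if "v \<in> V" "v \<noteq> VE" "T (VB i) v \<noteq> None" "T (VC (S i)) v \<noteq> None" for v
    using that i by (cases v) (auto split: if_splits)
  have "z \<noteq> VE \<or> w \<noteq> VE" using * by auto
  then have n: "has_null_pair z w (VB ?k) (VC (S ?k))" "has_null_pair (VB ?k) (VC (S ?k)) z w"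
    using distant[of z] distant[of w] * zw unfolding has_null_pair_def by (auto simp: third_commute)
  obtain u where u: "T z w = Some u" using * by blast
  then have "u \<in> V" using third_mem[of z w u] zw by simp
  show ?thesis
  proof (cases u)
    case (VA k)
    show ?thesis
      by (rule Z_swap[of _ _ _ _ "VB ?k" "VC (S ?k)" "VA (P k)" "VA k"])
        (use i zw u n VA \<open>u \<in> V\<close> in \<open>auto simp: has_null_pair_def\<close>)
  next
    case (VB k)
    show ?thesis
      by (rule Z_swap[of _ _ _ _ "VB ?k" "VC (S ?k)" "VA k" "VC k"])
        (use i zw u n VB \<open>u \<in> V\<close> in \<open>auto simp: has_null_pair_def\<close>)
  next
    case (VC k)
    show ?thesis
      by (rule Z_swap[of _ _ _ _ "VB ?k" "VC (S ?k)" "VA k" "VB k"])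
        (use i zw u n VC \<open>u \<in> V\<close> in \<open>auto simp: has_null_pair_def\<close>)
  next
    case VD
    show ?thesis
      by (rule Z_swap[of _ _ _ _ "VB ?k" "VC (S ?k)" "VA ?k" "VB (S ?k)"])
        (use i zw u n VD in \<open>auto simp: has_null_pair_def\<close>)
  next
    case VE
    show ?thesis
      by (rule Z_swap[of _ _ _ _ "VB ?k" "VC (S ?k)" "VB (S (S i))" "VC ?k"])
        (use i zw u n VE in \<open>auto simp: has_null_pair_def\<close>)
  qed
qed

text \<open>The quartics in which every pair of variables lies in a term of the cubic, apart from those with a
  factor \<open>a\<^sub>i b\<^sub>i\<^sub>+\<^sub>1\<close> or \<open>b\<^sub>i c\<^sub>i\<^sub>+\<^sub>1\<close>. The replacement quadrics were found by a computer search; only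
  the monomials of \<open>clique_cubes\<close> need two steps.\<close>

lemma clique_A:
  assumes "i < m"
  shows "Z {#VA i, VA i, VA i, VA i#}"
    "Z {#VA i, VA i, VA i, VA (S i)#}"
    "Z {#VA i, VA i, VA i, VB i#}"
    "Z {#VA i, VA i, VA i, VC i#}"
    "Z {#VA i, VA i, VA i, VD#}"
    "Z {#VA i, VA (S i), VA i, VA (S i)#}"
    "Z {#VA i, VA i, VA (S i), VD#}"
    "Z {#VA i, VB i, VA i, VB i#}"
    "Z {#VA i, VB i, VA i, VC i#}"
    "Z {#VA i, VA i, VB i, VD#}"
    "Z {#VA i, VA i, VC i, VC i#}"
    "Z {#VA i, VD, VA (S i), VA (S i)#}"
    "Z {#VA i, VB i, VB i, VB i#}"
    "Z {#VA i, VB i, VB i, VC i#}"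
    "Z {#VA i, VD, VB i, VB i#}"
    "Z {#VA i, VC i, VB i, VC i#}"
    "Z {#VA i, VC i, VC i, VC i#}"
  using assms
  by (simp_all add: has_null_pair_def
      Z_swap[of "VA i" "VA i" "VA i" "VA i" "VA (P (P i))" "VA (P i)" "VB (P i)" "VC (P i)"]
      Z_swap[of "VA i" "VA i" "VA i" "VA (S i)" "VB i" VD "VB (S (S i))" VD]
      Z_swap[of "VA i" "VA i" "VA i" "VB i" "VA (P (P i))" "VA (P i)" "VB (P i)" VE]
      Z_swap[of "VA i" "VA i" "VA i" "VC i" "VB i" VD "VC (S i)" VE]
      Z_swap[of "VA i" "VA i" "VA i" VD "VB i" VD "VC (S (S i))" VE]
      Z_swap[of "VA i" "VA (S i)" "VA i" "VA (S i)" "VB (S (S i))" VD "VB (S (S i))" VD]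
      Z_swap[of "VA i" "VA i" "VA (S i)" VD "VB i" VD "VB (S i)" "VB (S (S i))"]
      Z_swap[of "VA i" "VB i" "VA i" "VB i" "VB (P i)" VE "VB (P i)" VE]
      Z_swap[of "VA i" "VB i" "VA i" "VC i" "VB (P i)" VE "VC (S i)" VE]
      Z_swap[of "VA i" "VA i" "VB i" VD "VB i" VD "VB (P i)" "VC (P i)"]
      Z_swap[of "VA i" "VA i" "VC i" "VC i" "VB i" VD "VB (P (P i))" VE]
      Z_swap[of "VA i" VD "VA (S i)" "VA (S i)" "VB i" "VB (S i)" "VB i" "VC i"]
      Z_swap[of "VA i" "VB i" "VB i" "VB i" "VC (P i)" "VC i" "VA (P (P i))" VD]
      Z_swap[of "VA i" "VB i" "VB i" "VC i" "VC (P i)" "VC i" "VA (S i)" "VA (S i)"]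
      Z_swap[of "VA i" VD "VB i" "VB i" "VC (S (S i))" VE "VC i" VE]
      Z_swap[of "VA i" "VC i" "VB i" "VC i" "VA (P i)" VD "VB (S i)" VD]
      Z_swap[of "VA i" "VC i" "VC i" "VC i" "VA (P i)" VD "VB (P (P i))" VE])

lemma clique_B:
  assumes "i < m"
  shows "Z {#VB i, VB i, VB i, VB i#}"
    "Z {#VB i, VB i, VB i, VB (S i)#}"
    "Z {#VB i, VB i, VB i, VC i#}"
    "Z {#VB i, VB i, VB i, VD#}"
    "Z {#VB i, VB i, VB i, VE#}"
    "Z {#VB i, VB (S i), VB i, VB (S i)#}"
    "Z {#VB i, VB i, VB (S i), VD#}"
    "Z {#VB i, VB (S i), VB i, VE#}"
    "Z {#VB i, VC i, VB i, VC i#}"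
    "Z {#VB i, VB i, VC i, VE#}"
    "Z {#VB i, VB (S i), VB (S i), VD#}"
    "Z {#VB i, VE, VB (S i), VB (S i)#}"
    "Z {#VB i, VC i, VC i, VC i#}"
    "Z {#VB i, VC i, VC i, VE#}"
  using assms
  by (simp_all add: has_null_pair_def
      Z_swap[of "VB i" "VB i" "VB i" "VB i" "VA (P (P i))" VD "VA (P (P i))" VD]
      Z_swap[of "VB i" "VB i" "VB i" "VB (S i)" "VC i" VE "VC (S (S i))" VE]
      Z_swap[of "VB i" "VB i" "VB i" "VC i" "VA (P (P i))" VD "VA (S i)" "VA (S i)"]
      Z_swap[of "VB i" "VB i" "VB i" VD "VC i" VE "VA (P (P i))" "VA (P i)"]
      Z_swap[of "VB i" "VB i" "VB i" VE "VC i" VE "VA (S i)" "VB (S i)"]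
      Z_swap[of "VB i" "VB (S i)" "VB i" "VB (S i)" "VC (S (S i))" VE "VC (S (S i))" VE]
      Z_swap[of "VB i" "VB i" "VB (S i)" VD "VC i" VE "VA (S i)" "VA (S i)"]
      Z_swap[of "VB i" "VB (S i)" "VB i" VE "VA i" VD "VC i" "VC (S i)"]
      Z_swap[of "VB i" "VC i" "VB i" "VC i" "VB (S i)" VD "VB (S i)" VD]
      Z_swap[of "VB i" "VB i" "VC i" VE "VC i" VE "VA (P (P i))" VD]
      Z_swap[of "VB i" "VB (S i)" "VB (S i)" VD "VA i" VD "VB i" "VC i"]
      Z_swap[of "VB i" VE "VB (S i)" "VB (S i)" "VC i" "VC (S i)" "VA i" "VC i"]
      Z_swap[of "VB i" "VC i" "VC i" "VC i" "VB (S i)" VD "VB (P (P i))" VE]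
      Z_swap[of "VB i" "VC i" "VC i" VE "VB (S i)" VD "VA (P (P i))" VD])

lemma clique_C:
  assumes "i < m"
  shows "Z {#VC i, VC i, VC i, VC i#}"
    "Z {#VC i, VC i, VC i, VC (S i)#}"
    "Z {#VC i, VC i, VC i, VE#}"
    "Z {#VC i, VC (S i), VC i, VC (S i)#}"
    "Z {#VC i, VC (S i), VC i, VE#}"
    "Z {#VC i, VC (S i), VC (S i), VE#}"
  using assms
  by (simp_all add: has_null_pair_def
      Z_swap[of "VC i" "VC i" "VC i" "VC i" "VB (P (P i))" VE "VB (P (P i))" VE]
      Z_swap[of "VC i" "VC i" "VC i" "VC (S i)" "VB (P (P i))" VE "VA (S i)" "VB (S i)"]
      Z_swap[of "VC i" "VC i" "VC i" VE "VB (P (P i))" VE "VA (P (P i))" VD]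
      Z_swap[of "VC i" "VC (S i)" "VC i" "VC (S i)" "VC (S (S i))" "VC (S (S i))" "VA (S i)" "VB (S i)"]
      Z_swap[of "VC i" "VC (S i)" "VC i" VE "VB i" VE "VA (P (P i))" VD]
      Z_swap[of "VC i" "VC (S i)" "VC (S i)" VE "VB i" VE "VA i" "VC i"])

lemma clique_cubes:
  assumes i: "i < m"
  shows "Z {#VA i, VA (S i), VA (S i), VA (S i)#}"
    and "Z {#VB i, VB (S i), VB (S i), VB (S i)#}"
    and "Z {#VC i, VC (S i), VC (S i), VC (S i)#}"
proof -
  note AC = add_mset_commute
  show "Z {#VA i, VA (S i), VA (S i), VA (S i)#}"
  proof (rule swap[of _ _ _ _ "VB (S i)" "VC (S i)" "VB i" "VC i"])
    \<comment> \<open>This mixed product has no null pair; it is a quartic of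
      \<open>clique_A\<close> at the index \<open>S i\<close>, whence the second step.\<close>
    show "Z {#VB (S i), VC (S i), VA (S i), VA (S i)#}"
      using clique_A[of "S i"] i by (simp add: AC)
  qed (use i in \<open>auto intro!: Z_has_null_pair simp: has_null_pair_def\<close>)
  show "Z {#VB i, VB (S i), VB (S i), VB (S i)#}"
  proof (rule swap[of _ _ _ _ "VA (S i)" "VC (S i)" "VA i" "VC i"])
    show "Z {#VA (S i), VC (S i), VB (S i), VB (S i)#}"
      using clique_A[of "S i"] i by (simp add: AC)
  qed (use i in \<open>auto intro!: Z_has_null_pair simp: has_null_pair_def\<close>)
  show "Z {#VC i, VC (S i), VC (S i), VC (S i)#}"
  proof (rule swap[of _ _ _ _ "VA (S i)" "VB (S i)" "VA i" "VB i"])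
    show "Z {#VA (S i), VB (S i), VC (S i), VC (S i)#}"
      using clique_A[of "S i"] i by (simp add: AC)
  qed (use i in \<open>auto intro!: Z_has_null_pair simp: has_null_pair_def\<close>)
qed

text \<open>These are the pairs covered by \<open>Z_null\<close>, \<open>Z_AB\<close> and
  \<open>Z_BC\<close>: the only quadrics of class d and e are a_i b_{i+1} and b_i c_{i+1}.\<close>

definition weak_pair where "weak_pair x y \<longleftrightarrow> T x y \<in> {None, Some VD, Some VE}"

lemma Z_weak_pair:
  assumes xyzw: "{x, y, z, w} \<subseteq> V" and "weak_pair x y"
  shows "Z {#x, y, z, w#}"
proof -
  consider "T x y = None" | i where "{#x, y#} = {#VA i, VB (S i)#}" "i < m"
    | i where "{#x, y#} = {#VB i, VC (S i)#}" "i < m"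
    using assms unfolding weak_pair_def
    by (cases x; cases y) (auto split: if_splits simp: add_mset_commute)
  then show ?thesis
  proof cases
    case (2 i)
    have "{#x, y, z, w#} = {#x, y#} + {#z, w#}" by simp
    also have "\<dots> = {#VA i, VB (S i), z, w#}" unfolding 2(1) by simp
    finally have *: "{#x, y, z, w#} = {#VA i, VB (S i), z, w#}" .
    show ?thesis unfolding * using Z_AB[of i z w] 2(2) xyzw by simp
  next
    case (3 i)
    have "{#x, y, z, w#} = {#x, y#} + {#z, w#}" by simp
    also have "\<dots> = {#VB i, VC (S i), z, w#}" unfolding 3(1) by simp
    finally have *: "{#x, y, z, w#} = {#VB i, VC (S i), z, w#}" .
    show ?thesis unfolding * using Z_BC[of i z w] 3(2) xyzw by simp
  qed (use Z_null[of x y z w] xyzw in simp)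
qed

lemma Z_weak:
  assumes "{x, y, z, w} \<subseteq> V"
    "weak_pair x y \<or> weak_pair x z \<or> weak_pair x w \<or> weak_pair y z \<or> weak_pair y w \<or> weak_pair z w"
  shows "Z {#x, y, z, w#}"
  using assms(2)
proof (elim disjE)
qed (use assms(1) Z_weak_pair[of x y z w] Z_weak_pair[of x z y w] Z_weak_pair[of x w y z]
    Z_weak_pair[of y z x w] Z_weak_pair[of y w x z] Z_weak_pair[of z w x y] in
    \<open>simp_all add: add_mset_commute\<close>)

lemma not_weak_A:
  assumes "i < m" "y \<in> V" "\<not> weak_pair (VA i) y"
  shows "y \<in> {VA i, VA (S i), VA (P i), VB i, VC i, VD}"
  using assms by (cases y) (auto simp: weak_pair_def split: if_splits)

text \<open>Without weak pairs, the other factors lie among six neighbours of \<open>VA i\<close>.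
  The facts are needed at \<open>P i\<close> as well, since \<open>VA i\<close> may be the later of
  two consecutive a-variables.\<close>

lemma Z_with_A:
  assumes i: "i < m" and yzw: "{y, z, w} \<subseteq> V"
  shows "Z {#VA i, y, z, w#}"
proof (cases "weak_pair (VA i) y \<or> weak_pair (VA i) z \<or> weak_pair (VA i) w \<or> weak_pair y z \<or> weak_pair y w \<or> weak_pair z w")
  case False
  note facts = clique_A[OF i] clique_A[OF prv_less[OF i]] clique_cubes(1)[OF i] clique_cubes(1)[OF prv_less[OF i]]
  note F = facts[simplified nxt_prv[OF i] add_mset_commute]
  have "y \<in> {VA i, VA (S i), VA (P i), VB i, VC i, VD}" "z \<in> {VA i, VA (S i), VA (P i), VB i, VC i, VD}"
    "w \<in> {VA i, VA (S i), VA (P i), VB i, VC i, VD}" "\<not> weak_pair y z" "\<not> weak_pair y w" "\<not> weak_pair z w"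
    using False not_weak_A[OF i] yzw by auto
  then show ?thesis
    unfolding insert_iff empty_iff
    by (elim disjE FalseE; simp only:; simp add: add_mset_commute weak_pair_def i F)
qed (use Z_weak i yzw in simp)

lemma not_weak_B:
  assumes "i < m" "y \<in> V - range VA" "\<not> weak_pair (VB i) y"
  shows "y \<in> {VB i, VB (S i), VB (P i), VC i, VD, VE}"
  using assms by (cases y) (auto simp: weak_pair_def split: if_splits)

lemma Z_with_B:
  assumes i: "i < m" and yzw: "{y, z, w} \<subseteq> V - range VA"
  shows "Z {#VB i, y, z, w#}"
proof (cases "weak_pair (VB i) y \<or> weak_pair (VB i) z \<or> weak_pair (VB i) w \<or> weak_pair y z \<or> weak_pair y w \<or> weak_pair z w")
  case False
  note facts = clique_B[OF i] clique_B[OF prv_less[OF i]] clique_cubes(2)[OF i] clique_cubes(2)[OF prv_less[OF i]]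
  note F = facts[simplified nxt_prv[OF i] add_mset_commute]
  have "y \<in> {VB i, VB (S i), VB (P i), VC i, VD, VE}" "z \<in> {VB i, VB (S i), VB (P i), VC i, VD, VE}"
    "w \<in> {VB i, VB (S i), VB (P i), VC i, VD, VE}" "\<not> weak_pair y z" "\<not> weak_pair y w" "\<not> weak_pair z w"
    using False not_weak_B[OF i] yzw by auto
  then show ?thesis
    unfolding insert_iff empty_iff
    by (elim disjE FalseE; simp only:; simp add: add_mset_commute weak_pair_def i F)
qed (use Z_weak i yzw in auto)

lemma not_weak_C:
  assumes "i < m" "y \<in> V - (range VA \<union> range VB)" "\<not> weak_pair (VC i) y"
  shows "y \<in> {VC i, VC (S i), VC (P i), VE}"
  using assms by (cases y) (auto simp: weak_pair_def split: if_splits)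

lemma Z_with_C:
  assumes i: "i < m" and yzw: "{y, z, w} \<subseteq> V - (range VA \<union> range VB)"
  shows "Z {#VC i, y, z, w#}"
proof (cases "weak_pair (VC i) y \<or> weak_pair (VC i) z \<or> weak_pair (VC i) w \<or> weak_pair y z \<or> weak_pair y w \<or> weak_pair z w")
  case False
  note facts = clique_C[OF i] clique_C[OF prv_less[OF i]] clique_cubes(3)[OF i] clique_cubes(3)[OF prv_less[OF i]]
  note F = facts[simplified nxt_prv[OF i] add_mset_commute]
  have "y \<in> {VC i, VC (S i), VC (P i), VE}" "z \<in> {VC i, VC (S i), VC (P i), VE}"
    "w \<in> {VC i, VC (S i), VC (P i), VE}" "\<not> weak_pair y z" "\<not> weak_pair y w" "\<not> weak_pair z w"
    using False not_weak_C[OF i] yzw by auto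
  then show ?thesis
    unfolding insert_iff empty_iff
    by (elim disjE FalseE; simp only:; simp add: add_mset_commute weak_pair_def i F)
qed (use Z_weak i yzw in auto)

lemma Z_quartic:
  assumes "{x, y, z, w} \<subseteq> V"
  shows "Z {#x, y, z, w#}"
proof -
  have A: "Z {#a, b, c, d#}" if "{a, b, c, d} \<subseteq> V" "a \<in> range VA" for a b c d
    using Z_with_A that by auto
  have B: "Z {#a, b, c, d#}" if "{a, b, c, d} \<subseteq> V - range VA" "a \<in> range VB" for a b c d
    using Z_with_B that by auto
  have C: "Z {#a, b, c, d#}" if "{a, b, c, d} \<subseteq> V - (range VA \<union> range VB)" "a \<in> range VC" for a b c d
    using Z_with_C that by auto
  have perm: "{#y, x, z, w#} = {#x, y, z, w#}" "{#z, x, y, w#} = {#x, y, z, w#}" "{#w, x, y, z#} = {#x, y, z, w#}"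
    by (simp_all add: add_mset_commute)
  show ?thesis
  proof (cases "{x, y, z, w} \<inter> range VA = {}")
    case False
    then show ?thesis
      using A[of x y z w] A[of y x z w] A[of z x y w] A[of w x y z] assms unfolding perm by auto
  next
    case noA: True
    show ?thesis
    proof (cases "{x, y, z, w} \<inter> range VB = {}")
      case False
      then show ?thesis
        using B[of x y z w] B[of y x z w] B[of z x y w] B[of w x y z] assms noA unfolding perm by auto
    next
      case noB: True
      show ?thesis
      proof (cases "{x, y, z, w} \<inter> range VC = {}")
        case False
        then show ?thesis
          using C[of x y z w] C[of y x z w] C[of z x y w] C[of w x y z] assms noA noB unfolding perm by auto
      next
        case True
        then have "x \<in> {VD, VE}" "y \<in> {VD, VE}"
          using noA noB by (cases x; cases y; simp)+
        \<comment> \<open>No term contains d^2, d e or e^2.\<close>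
        then show ?thesis
          using assms by (intro Z_null) auto
      qed
    qed
  qed
qed

end

section \<open>The two Hilbert functions\<close>

context cubic_indices begin

section \<open>The cubic as a sum of distinct monomials\<close>

definition terms_at :: "nat \<Rightarrow> cubic_var multiset set" where
  "terms_at i = {{#VA i, VB i, VC i#}, {#VA i, VA (S i), VA (S i)#}, {#VB i, VB (S i), VB (S i)#},
     {#VC i, VC (S i), VC (S i)#}, {#VA i, VB (S i), VD#}, {#VB i, VC (S i), VE#}}"

definition cubic_terms :: "cubic_var multiset set" where
  "cubic_terms = (\<Union>i<m. terms_at i)"

lemma third_mset_eq:
  assumes "{#x, y, z#} = {#a, b, c#}" "{x, y, z} \<subseteq> V" "T a b = Some c"
  shows "T x y = Some z"
proof -
  have V: "a \<in> V" "b \<in> V" "c \<in> V"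
    using assms(2) arg_cong[OF assms(1), of set_mset] by auto
  have *: "T b c = Some a" "T c a = Some b"
    using third_rotate[OF assms(3) V(1,2)] third_rotate[OF _ V(2,3)] by auto
  have "(x, y, z) \<in> {(a, b, c), (a, c, b), (b, a, c), (b, c, a), (c, a, b), (c, b, a)}"
    using assms(1) by (auto simp: add_eq_conv_ex)
  then show ?thesis
    using * assms(3) by (auto simp: third_commute[of b a] third_commute[of c b] third_commute[of a c])
qed

lemma in_cubic_terms_iff:
  assumes "{x, y, z} \<subseteq> V"
  shows "{#x, y, z#} \<in> cubic_terms \<longleftrightarrow> T x y = Some z"
proof
  assume "{#x, y, z#} \<in> cubic_terms"
  then obtain i where "i < m" "{#x, y, z#} \<in> terms_at i"
    unfolding cubic_terms_def by blast
  then show "T x y = Some z"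
    unfolding terms_at_def insert_iff empty_iff
    by (elim disjE FalseE; elim third_mset_eq[OF _ assms]) simp_all
next
  have mem: "M \<in> cubic_terms" if "M \<in> terms_at i" "i < m" for M i
    using that unfolding cubic_terms_def by blast
  assume T: "T x y = Some z"
  have xy: "x \<in> V" "y \<in> V" using assms by auto
  show "{#x, y, z#} \<in> cubic_terms"
  proof (cases x)
    case (VA i)
    then show ?thesis using T xy mem[of "{#x, y, z#}" i] mem[of "{#x, y, z#}" "P i"]
      by (cases y; simp split: if_splits; simp add: terms_at_def add_mset_commute)
  next
    case (VB i)
    then show ?thesis using T xy mem[of "{#x, y, z#}" i] mem[of "{#x, y, z#}" "P i"]
      by (cases y; simp split: if_splits; simp add: terms_at_def add_mset_commute)
  next
    case (VC i)
    then show ?thesis using T xy mem[of "{#x, y, z#}" i] mem[of "{#x, y, z#}" "P i"]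
      by (cases y; simp split: if_splits; simp add: terms_at_def add_mset_commute)
  next
    case VD
    then show ?thesis using T xy
    proof (cases y)
      case (VA k)
      then show ?thesis using VD T xy mem[of "{#x, y, z#}" k] by (simp add: terms_at_def add_mset_commute)
    next
      case (VB k)
      then show ?thesis using VD T xy mem[of "{#x, y, z#}" "P k"] by (simp add: terms_at_def add_mset_commute)
    qed simp_all
  next
    case VE
    then show ?thesis using T xy
    proof (cases y)
      case (VB k)
      then show ?thesis using VE T xy mem[of "{#x, y, z#}" k] by (simp add: terms_at_def add_mset_commute)
    next
      case (VC k)
      then show ?thesis using VE T xy mem[of "{#x, y, z#}" "P k"] by (simp add: terms_at_def add_mset_commute)
    qed simp_all
  qed
qed

lemma cubic_terms_size: "M \<in> cubic_terms \<Longrightarrow> size M = 3"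
  by (auto simp: cubic_terms_def terms_at_def)

lemma cubic_terms_subset: "M \<in> cubic_terms \<Longrightarrow> set_mset M \<subseteq> V"
  by (auto simp: cubic_terms_def terms_at_def)

lemma terms_at_neq:
  assumes "i < m"
  shows "{#VA i, VB i, VC i#} \<notin> {{#VA i, VA (S i), VA (S i)#}, {#VB i, VB (S i), VB (S i)#},
      {#VC i, VC (S i), VC (S i)#}, {#VA i, VB (S i), VD#}, {#VB i, VC (S i), VE#}}"
    "{#VA i, VA (S i), VA (S i)#} \<notin> {{#VB i, VB (S i), VB (S i)#},
      {#VC i, VC (S i), VC (S i)#}, {#VA i, VB (S i), VD#}, {#VB i, VC (S i), VE#}}"
    "{#VB i, VB (S i), VB (S i)#} \<notin> {
      {#VC i, VC (S i), VC (S i)#}, {#VA i, VB (S i), VD#}, {#VB i, VC (S i), VE#}}"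
    "{#VC i, VC (S i), VC (S i)#} \<notin> {{#VA i, VB (S i), VD#}, {#VB i, VC (S i), VE#}}"
    "{#VA i, VB (S i), VD#} \<notin> {{#VB i, VC (S i), VE#}}"
  by (auto dest!: arg_cong[where f = set_mset])

text \<open>The set of indices in a term recovers \<open>i\<close>:
  \<open>{i, S i} = {j, S j}\<close> with \<open>i \<noteq> j\<close> would force
  \<open>S (S i) = i\<close>. Hence different values of \<open>i\<close> share no term.\<close>

lemma terms_at_indices:
  assumes "M \<in> terms_at i"
  shows "{j. VA j \<in># M \<or> VB j \<in># M \<or> VC j \<in># M} \<in> {{i}, {i, S i}}"
proof -
  have "{j. VA j \<in># M \<or> VB j \<in># M \<or> VC j \<in># M} = {i} \<or>
      {j. VA j \<in># M \<or> VB j \<in># M \<or> VC j \<in># M} = {i, S i}"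
    using assms unfolding terms_at_def by auto
  then show ?thesis by blast
qed

lemma terms_at_disjoint:
  assumes "i < m" "j < m" "M \<in> terms_at i" "M \<in> terms_at j"
  shows "i = j"
proof -
  have "{i} = {j} \<or> {i} = {j, S j} \<or> {i, S i} = {j} \<or> {i, S i} = {j, S j}"
    using terms_at_indices[OF assms(3)] terms_at_indices[OF assms(4)] by auto
  then show ?thesis
    using nxt_neq(2)[OF assms(1)] by (auto simp: doubleton_eq_iff)
qed

text \<open>Summing over a set requires that no monomial is listed twice. This is also why every
  coefficient of the cubic is 1, in any characteristic.\<close>

lemma cubic_pol_eq: "(cubic_pol m :: (cubic_var, 'k::field) mpol) = (\<Sum>M\<in>cubic_terms. monom_pol M)"
proof -
  have "cubic_pol m = (\<Sum>i<m. \<Sum>M\<in>terms_at i. monom_pol M :: (cubic_var, 'k) mpol)"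
    unfolding cubic_pol_def Let_def
  proof (rule sum.cong)
    fix i assume "i \<in> {..<m}"
    then have i: "i < m" by simp
    then have mods: "i mod m = i" "(i + 1) mod m = S i"
      by (auto simp: nxt_def mod_Suc)
    show "indet (VA (i mod m)) * indet (VB (i mod m)) * indet (VC (i mod m)) +
         indet (VA (i mod m)) * (indet (VA ((i + 1) mod m)))\<^sup>2 +
         indet (VB (i mod m)) * (indet (VB ((i + 1) mod m)))\<^sup>2 +
         indet (VC (i mod m)) * (indet (VC ((i + 1) mod m)))\<^sup>2 +
         indet (VA (i mod m)) * indet (VB ((i + 1) mod m)) * indet VD +
         indet (VB (i mod m)) * indet (VC ((i + 1) mod m)) * indet VE =
         (\<Sum>M\<in>terms_at i. monom_pol M :: (cubic_var, 'k) mpol)"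
      unfolding mods indet_eq_monom_pol power2_eq_square monom_pol_mult terms_at_def
      using terms_at_neq[OF i] by (simp add: add_mset_commute add.assoc)
  qed simp
  also have "\<dots> = (\<Sum>M\<in>cubic_terms. monom_pol M)"
    unfolding cubic_terms_def
  proof (rule sum.UNION_disjoint[symmetric])
    show "\<forall>i\<in>{..<m}. finite (terms_at i)" unfolding terms_at_def by simp
    show "\<forall>i\<in>{..<m}. \<forall>j\<in>{..<m}. i \<noteq> j \<longrightarrow> terms_at i \<inter> terms_at j = {}"
      using terms_at_disjoint by blast
  qed simp
  finally show ?thesis .
qed

lemma lookup_cubic_form [simp]:
  "Poly_Mapping.lookup (cubic_form m :: (cubic_var, 'k::field) dpol) (Dual (monom_of M)) = of_bool (M \<in> cubic_terms)"
proof -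
  have "finite cubic_terms" unfolding cubic_terms_def terms_at_def by simp
  then show ?thesis
    unfolding cubic_form_def lookup_dual_of cubic_pol_eq lookup_sum
    by (simp add: monom_pol_def lookup_single when_def of_bool_def)
qed

section \<open>The Hilbert function of the apolar algebra\<close>

abbreviation "F \<equiv> cubic_form m"
abbreviation "I \<equiv> Ann V F"
abbreviation "I2 \<equiv> ideal_prod (pol_ring V) I I"

text \<open>By \<open>lookup_contract\<close>, \<open>lin (shifted N) s\<close> is the coefficient
  of the dual of \<open>monom_of N\<close> in the contraction of the cubic by
  \<open>s\<close>.\<close>

definition shifted :: "cubic_var multiset \<Rightarrow> cubic_var monom \<Rightarrow> 'k::field" where
  "shifted N \<nu> = Poly_Mapping.lookup F (Dual (\<nu> + monom_of N))"

lemma shifted_monom_of [simp]: "shifted N (monom_of M) = of_bool (M + N \<in> cubic_terms)"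
  unfolding shifted_def monom_of_union[symmetric] by simp

lemma lin_shifted_Ann: "s \<in> I \<Longrightarrow> lin (shifted N) s = 0"
  unfolding Ann_def contract_eq_0_iff shifted_def by blast

lemma in_Ann_iff: "s \<in> I \<longleftrightarrow> s \<in> carrier (pol_ring V) \<and> (\<forall>N. lin (shifted N) s = 0)"
proof -
  have "(\<forall>\<rho>. lin (\<lambda>\<nu>. Poly_Mapping.lookup F (Dual (\<nu> + \<rho>))) s = 0) \<longleftrightarrow> (\<forall>N. lin (shifted N) s = 0)"
    unfolding shifted_def by (metis monom_of_exhaust)
  then show ?thesis unfolding Ann_def contract_eq_0_iff by blast
qed

text \<open>The cubic is homogeneous of degree 3 in the variables of \<open>V\<close>, so only
  multisets \<open>N\<close> of complementary size over \<open>V\<close> can give a nonzero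
  functional.\<close>

lemma hom_part_in_Ann:
  assumes s: "s \<in> hom_part V i"
    and zero: "\<And>N. size N + i = 3 \<Longrightarrow> set_mset N \<subseteq> V \<Longrightarrow> lin (shifted N) s = 0"
  shows "s \<in> I"
proof -
  have "lin (shifted N) s = 0" for N
  proof (cases "size N + i = 3 \<and> set_mset N \<subseteq> V")
    case False
    then show ?thesis
      using cubic_terms_size cubic_terms_subset by (intro lin_hom_part_eq_0[OF s]) fastforce
  qed (use zero in blast)
  then show ?thesis
    using s unfolding in_Ann_iff hom_part_def by blast
qed

lemma finite_V: "finite V"
  by (simp add: cubic_vars_def)

lemma in_cubic_terms_iff':
  assumes "{w, x, y} \<subseteq> V"
  shows "{#w, x, y#} \<in> cubic_terms \<longleftrightarrow> T x y = Some w"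
proof -
  have eq: "{#w, x, y#} = {#x, y, w#}" by (simp add: add_mset_commute)
  show ?thesis unfolding eq using assms by (intro in_cubic_terms_iff) auto
qed

lemma obtain_third:
  obtains r s where "\<And>v. v \<in> V \<Longrightarrow> {r v, s v} \<subseteq> V" "\<And>v. v \<in> V \<Longrightarrow> T (r v) (s v) = Some v"
proof -
  have "\<exists>r s. {r, s} \<subseteq> V \<and> T r s = Some v" if "v \<in> V" for v
  proof (cases v)
    case (VA i)
    then show ?thesis using that by (intro exI[of _ "VB i"] exI[of _ "VC i"]) simp
  next
    case (VB i)
    then show ?thesis using that by (intro exI[of _ "VA i"] exI[of _ "VC i"]) simp
  next
    case (VC i)
    then show ?thesis using that by (intro exI[of _ "VA i"] exI[of _ "VB i"]) simp
  next
    case VD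
    then show ?thesis by (intro exI[of _ "VA 0"] exI[of _ "VB (S 0)"]) simp
  next
    case VE
    then show ?thesis by (intro exI[of _ "VB 0"] exI[of _ "VC (S 0)"]) simp
  qed
  then show ?thesis using that by metis
qed

lemma hilbert_0: "hilbert_value V (I :: (cubic_var, 'k::field) mpol set) 0 1"
proof -
  let ?t = "{#VA 0, VB 0, VC 0#}"
  have t: "?t \<in> cubic_terms" by (simp add: in_cubic_terms_iff)
  have "hilbert_value V (I :: (cubic_var, 'k) mpol set) 0 (card {()})"
  proof (rule hilbert_valueI[where b = "\<lambda>_. monom_pol {#}" and g = "\<lambda>_. shifted ?t"])
    show "monom_pol {#} \<in> hom_part V 0" by (rule monom_pol_hom_part) simp_all
    show "s \<in> I" if s: "s \<in> hom_part V 0" and z: "\<And>a. a \<in> {()} \<Longrightarrow> lin (shifted ?t) s = 0" for s :: "(cubic_var, 'k) mpol"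
    proof (rule hom_part_in_Ann[OF s])
      fix N :: "cubic_var multiset" assume "size N + 0 = 3" "set_mset N \<subseteq> V"
      have "lin (shifted N) s = lin (\<lambda>\<mu>. of_bool (N \<in> cubic_terms) * shifted ?t \<mu>) s"
        using t by (intro lin_hom_part_cong[OF s]) simp
      then show "lin (shifted N) s = 0" using z unfolding lin_fun_mult by simp
    qed
  qed (use t in \<open>auto simp: ideal_Ann lin_shifted_Ann\<close>)
  then show ?thesis by simp
qed

text \<open>The quadrics \<open>r v s v\<close>, one from each class, act as functionals dual to the
  variables. \<open>hilbert_2\<close> uses the same pairing with the roles exchanged.\<close>

lemma hilbert_1: "hilbert_value V (I :: (cubic_var, 'k::field) mpol set) 1 (card V)"
proof -
  obtain r s where rs: "\<And>v. v \<in> V \<Longrightarrow> {r v, s v} \<subseteq> V" "\<And>v. v \<in> V \<Longrightarrow> T (r v) (s v) = Some v"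
    by (rule obtain_third) blast
  have val: "{#r v, s v, w#} \<in> cubic_terms \<longleftrightarrow> v = w" if "v \<in> V" "w \<in> V" for v w
    using in_cubic_terms_iff[of "r v" "s v" w] rs that by auto
  show ?thesis
  proof (rule hilbert_valueI[where b = "\<lambda>v. monom_pol {#v#}" and g = "\<lambda>v. shifted {#r v, s v#}"])
    show "monom_pol {#v#} \<in> hom_part V 1" if "v \<in> V" for v
      by (rule monom_pol_hom_part) (use that in simp_all)
    show "p \<in> I" if p: "p \<in> hom_part V 1" and z: "\<And>v. v \<in> V \<Longrightarrow> lin (shifted {#r v, s v#}) p = 0"
      for p :: "(cubic_var, 'k) mpol"
    proof (rule hom_part_in_Ann[OF p])
      fix N :: "cubic_var multiset" assume N: "size N + 1 = 3" "set_mset N \<subseteq> V"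
      then obtain x M where x: "N = add_mset x M"
        using size_eq_Suc_imp_eq_union[of N 1] by auto
      then obtain y where "M = {#y#}"
        using size_1_singleton_mset[of M] N by auto
      with x have xy: "N = {#x, y#}" by simp
      have V: "x \<in> V" "y \<in> V" using N xy by auto
      show "lin (shifted N) p = 0"
      proof (cases "T x y")
        case None
        show ?thesis
        proof (rule lin_hom_part_eq_0[OF p])
          fix M assume "size M = 1" "set_mset M \<subseteq> V"
          then obtain w where "M = {#w#}" "w \<in> V" using size_1_singleton_mset[of M] by auto
          then show "shifted N (monom_of M) = (0 :: 'k)" using None xy V by (simp add: in_cubic_terms_iff)
        qed
      next
        case (Some v)
        then have v: "v \<in> V" using third_mem V by blast
        have "lin (shifted N) p = lin (shifted {#r v, s v#}) p"
        proof (rule lin_hom_part_cong[OF p])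
          fix M assume "size M = 1" "set_mset M \<subseteq> V"
          then obtain w where "M = {#w#}" "w \<in> V" using size_1_singleton_mset[of M] by auto
          then show "shifted N (monom_of M) = (shifted {#r v, s v#} (monom_of M) :: 'k)"
            using Some xy V val[OF v] by (simp add: in_cubic_terms_iff)
        qed
        then show ?thesis using z v by simp
      qed
    qed
    show "lin (shifted {#r v, s v#}) (monom_pol {#w#}) = (of_bool (v = w) :: 'k)" if "v \<in> V" "w \<in> V" for v w
      using val that by simp
  qed (simp_all add: ideal_Ann lin_shifted_Ann finite_V)
qed

lemma hilbert_2: "hilbert_value V (I :: (cubic_var, 'k::field) mpol set) 2 (card V)"
proof -
  obtain r s where rs: "\<And>v. v \<in> V \<Longrightarrow> {r v, s v} \<subseteq> V" "\<And>v. v \<in> V \<Longrightarrow> T (r v) (s v) = Some v"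
    by (rule obtain_third) blast
  show ?thesis
  proof (rule hilbert_valueI[where b = "\<lambda>v. monom_pol {#r v, s v#}" and g = "\<lambda>v. shifted {#v#}"])
    show "monom_pol {#r v, s v#} \<in> hom_part V 2" if "v \<in> V" for v
      by (rule monom_pol_hom_part) (use rs(1)[OF that] in simp_all)
    show "p \<in> I" if p: "p \<in> hom_part V 2" and z: "\<And>v. v \<in> V \<Longrightarrow> lin (shifted {#v#}) p = 0"
      for p :: "(cubic_var, 'k) mpol"
    proof (rule hom_part_in_Ann[OF p])
      fix N :: "cubic_var multiset" assume N: "size N + 2 = 3" "set_mset N \<subseteq> V"
      then obtain v where "N = {#v#}" "v \<in> V" using size_1_singleton_mset[of N] by auto
      then show "lin (shifted N) p = 0" using z by simp
    qed
    show "lin (shifted {#v#}) (monom_pol {#r w, s w#}) = (of_bool (v = w) :: 'k)" if "v \<in> V" "w \<in> V" for v w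
      using in_cubic_terms_iff'[of v "r w" "s w"] rs(1,2)[OF that(2)] that
      by (simp add: add_mset_commute[of _ v] eq_commute[of v])
  qed (simp_all add: ideal_Ann lin_shifted_Ann finite_V)
qed

lemma hilbert_3: "hilbert_value V (I :: (cubic_var, 'k::field) mpol set) 3 1"
proof -
  let ?t = "{#VA 0, VB 0, VC 0#}"
  have t: "?t \<in> cubic_terms" by (simp add: in_cubic_terms_iff)
  have "hilbert_value V (I :: (cubic_var, 'k) mpol set) 3 (card {()})"
  proof (rule hilbert_valueI[where b = "\<lambda>_. monom_pol ?t" and g = "\<lambda>_. shifted {#}"])
    show "monom_pol ?t \<in> hom_part V 3" by (rule monom_pol_hom_part) simp_all
    show "s \<in> I" if s: "s \<in> hom_part V 3" and z: "\<And>a. a \<in> {()} \<Longrightarrow> lin (shifted {#}) s = 0" for s :: "(cubic_var, 'k) mpol"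
      using z by (intro hom_part_in_Ann[OF s]) simp
  qed (use t in \<open>auto simp: ideal_Ann lin_shifted_Ann\<close>)
  then show ?thesis by simp
qed

lemma hilbert_ge_4: "i \<ge> 4 \<Longrightarrow> hilbert_value V (I :: (cubic_var, 'k::field) mpol set) i 0"
  using hilbert_valueI[of I V "{}" "\<lambda>_. 0" i "\<lambda>_. shifted {#}"] hom_part_in_Ann[of _ i] ideal_Ann[of V F]
  by auto

lemma hilbert_Ann: "has_hilbert_function V (I :: (cubic_var, 'k::field) mpol set) [1, card V, card V, 1]"
  unfolding has_hilbert_function_def
proof
  fix i :: nat
  consider "i = 0" | "i = 1" | "i = 2" | "i = 3" | "i \<ge> 4" by linarith
  then show "hilbert_value V (I :: (cubic_var, 'k::field) mpol set) i
      (if i < length [1, card V, card V, 1] then [1, card V, card V, 1] ! i else 0)"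
    by cases (use hilbert_0 hilbert_1 hilbert_2 hilbert_3 hilbert_ge_4 in \<open>simp_all add: numeral_eq_Suc\<close>)
qed

section \<open>The square of the apolar ideal in degree four\<close>

text \<open>The value of \<open>deriv_coeff v\<close> at \<open>\<mu>\<close> is the coefficient of \<open>\<mu>\<^sup>*\<close> in the divided power product of \<open>v\<^sup>*\<close> and
  the cubic. By the Leibniz rule, this product is killed by the square of the apolar ideal.\<close>

definition deriv_coeff :: "cubic_var \<Rightarrow> cubic_var monom \<Rightarrow> 'k::field" where
  "deriv_coeff v \<mu> = of_nat (Poly_Mapping.lookup \<mu> v) *
     Poly_Mapping.lookup F (Dual (\<mu> - Poly_Mapping.single v 1))"

lemma monom_of_diff_single: "monom_of M - Poly_Mapping.single v 1 = monom_of (M - {#v#})"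
  by (rule poly_mapping_eqI) (simp add: lookup_minus lookup_single when_def)

lemma deriv_coeff_monom_of:
  "deriv_coeff v (monom_of M) = of_nat (count M v) * of_bool (M - {#v#} \<in> cubic_terms)"
  unfolding deriv_coeff_def monom_of_diff_single by simp

text \<open>\<open>A \<alpha> \<beta>\<close> is the Leibniz summand in which \<open>v\<close> is
  removed from \<open>\<alpha>\<close>. For fixed \<open>\<alpha>\<close> it is a multiple of some
  \<open>shifted N\<close> and so vanishes on the ideal; the other summand is handled by exchanging
  the factors.\<close>

lemma lin_deriv_coeff_mult:
  assumes "p \<in> I" "q \<in> I"
  shows "lin (deriv_coeff v) (p * q) = 0"
proof -
  define A :: "cubic_var monom \<Rightarrow> cubic_var monom \<Rightarrow> 'a" where
    "A \<alpha> \<beta> = of_nat (Poly_Mapping.lookup \<alpha> v) *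
      Poly_Mapping.lookup F (Dual (\<beta> + (\<alpha> - Poly_Mapping.single v 1)))" for \<alpha> \<beta>
  have A: "A (monom_of M) (monom_of N) = of_nat (count M v) * of_bool (M - {#v#} + N \<in> cubic_terms)" for M N
    unfolding A_def monom_of_diff_single monom_of_union[symmetric] by (simp add: add.commute)
  have A_zero: "lin (A \<alpha>) r = 0" if "r \<in> I" for \<alpha> r
  proof -
    obtain M where "\<alpha> = monom_of M" by (rule monom_of_exhaust)
    then have "A \<alpha> = (\<lambda>\<beta>. of_nat (count M v) * shifted (M - {#v#}) \<beta>)"
      by (intro ext) (simp only: A_def monom_of_diff_single shifted_def lookup_monom_of)
    then show ?thesis using that by (simp add: lin_fun_mult lin_shifted_Ann)
  qed
  have "deriv_coeff v (\<alpha> + \<beta>) = A \<alpha> \<beta> + A \<beta> \<alpha>" for \<alpha> \<beta>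
  proof -
    obtain M N where MN: "\<alpha> = monom_of M" "\<beta> = monom_of N" by (metis monom_of_exhaust)
    \<comment> \<open>If \<open>v\<close> does not occur in \<open>K\<close>, the truncated
      difference \<open>K - {#v#}\<close> is just \<open>K\<close> and the two multisets may differ,
      but then the factor \<open>count K v\<close> is 0.\<close>
    have *: "count K v = 0 \<or> K - {#v#} + L = K + L - {#v#}" for K L
      by (cases "v \<in># K") (simp_all add: count_eq_zero_iff)
    have eq: "of_nat (count K v) * of_bool (K - {#v#} + L \<in> cubic_terms) =
        (of_nat (count K v) * of_bool (K + L - {#v#} \<in> cubic_terms) :: 'a)" for K L
      using *[of K L] by auto
    have "A \<alpha> \<beta> + A \<beta> \<alpha> = of_nat (count M v) * of_bool (M + N - {#v#} \<in> cubic_terms) +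
        of_nat (count N v) * of_bool (N + M - {#v#} \<in> cubic_terms)"
      by (simp only: MN A eq)
    also have "\<dots> = deriv_coeff v (\<alpha> + \<beta>)"
      unfolding MN monom_of_union[symmetric] deriv_coeff_monom_of
      by (simp add: add.commute[of N M] distrib_right)
    finally show ?thesis ..
  qed
  then have "lin (deriv_coeff v) (p * q) = lin (\<lambda>\<alpha>. lin (A \<alpha>) q) p + lin (\<lambda>\<alpha>. lin (\<lambda>\<beta>. A \<beta> \<alpha>) q) p"
    unfolding lin_mult by (simp add: lin_fun_add)
  moreover have "lin (\<lambda>\<alpha>. lin (\<lambda>\<beta>. A \<beta> \<alpha>) q) p = lin (\<lambda>\<beta>. lin (A \<beta>) p) q"
    by (rule lin_swap)
  ultimately show ?thesis
    using assms by (simp add: A_zero lin_def[of "\<lambda>_. 0"])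
qed

lemma ideal_I2: "ideal (I2 :: (cubic_var, 'k::field) mpol set) (pol_ring V)"
  by (rule ring.ideal_prod_is_ideal[OF pol_ring_ring ideal_Ann ideal_Ann])

lemma mult_in_I2: "p \<in> I \<Longrightarrow> q \<in> I \<Longrightarrow> p * q \<in> I2"
  using ideal_prod.prod[of p I q I "pol_ring V"] by simp

lemma lin_deriv_coeff_I2:
  assumes "p \<in> I2" shows "lin (deriv_coeff v) p = 0"
  using assms
proof induction
  case (prod i j)
  then show ?case by (simp add: lin_deriv_coeff_mult)
next
  case (sum s1 s2)
  then show ?case by (simp add: lin_add)
qed

text \<open>A hub has four distinct variables, so the multiplicity factor is 1 in every
  characteristic, and removing a variable other than \<open>w\<close> leaves no term of the
  cubic.\<close>

lemma hub_dual:
  assumes "v \<in> V" "w \<in> V"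
  shows "(deriv_coeff v (monom_of (hub m w)) :: 'k::field) = of_bool (v = w)"
proof (cases "v \<in># hub m w")
  case False
  then have "v \<noteq> w" by (cases w) auto
  then show ?thesis using False by (simp add: deriv_coeff_monom_of not_in_iff)
next
  case True
  then show ?thesis
    using assms by (cases w) (auto simp: deriv_coeff_monom_of in_cubic_terms_iff)
qed

lemma hub_size [simp]: "size (hub m v) = 4"
  by (cases v) auto

lemma hub_subset: "v \<in> V \<Longrightarrow> set_mset (hub m v) \<subseteq> V"
  by (cases v) auto

definition hub_span :: "(cubic_var, 'k::field) mpol set" where
  "hub_span = {p. \<exists>c. p - (\<Sum>v\<in>V. const_pol (c v) * monom_pol (hub m v)) \<in> I2}"

lemma I2_subset_hub_span: "p \<in> I2 \<Longrightarrow> p \<in> hub_span"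
  unfolding hub_span_def by (rule CollectI, rule exI[of _ "\<lambda>_. 0"]) (simp add: const_pol_def)

lemma const_pol_add: "const_pol (c + d) = const_pol c + const_pol d"
  by (simp add: const_pol_def single_add)

lemma const_pol_mult: "const_pol (c * d) = const_pol c * const_pol d"
  by (simp add: const_pol_def mult_single)

lemma hub_span_add:
  assumes "p \<in> hub_span" "q \<in> hub_span"
  shows "p + q \<in> hub_span"
proof -
  obtain c d where c: "p - (\<Sum>v\<in>V. const_pol (c v) * monom_pol (hub m v)) \<in> I2"
      and d: "q - (\<Sum>v\<in>V. const_pol (d v) * monom_pol (hub m v)) \<in> I2"
    using assms unfolding hub_span_def by blast
  have "p + q - (\<Sum>v\<in>V. const_pol (c v + d v) * monom_pol (hub m v)) \<in> I2"
    using ideal_add[OF ideal_I2 c d] by (simp add: const_pol_add distrib_right sum.distrib algebra_simps)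
  then show ?thesis
    unfolding hub_span_def by (intro CollectI exI[of _ "\<lambda>v. c v + d v"])
qed

lemma hub_span_const_mult:
  assumes "p \<in> hub_span"
  shows "const_pol a * p \<in> hub_span"
proof -
  obtain c where c: "p - (\<Sum>v\<in>V. const_pol (c v) * monom_pol (hub m v)) \<in> I2"
    using assms unfolding hub_span_def by blast
  have "const_pol a * p - (\<Sum>v\<in>V. const_pol (a * c v) * monom_pol (hub m v)) \<in> I2"
    using ideal_mult[OF ideal_I2 c carrier_const[of a]]
    by (simp add: const_pol_mult right_diff_distrib sum_distrib_left mult.assoc)
  then show ?thesis
    unfolding hub_span_def by (intro CollectI exI[of _ "\<lambda>v. a * c v"])
qed

lemma hub_span_diff:
  assumes "p \<in> hub_span" "q \<in> hub_span"
  shows "p - q \<in> hub_span"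
proof -
  have "const_pol (- 1) * q = - q"
    by (simp add: const_pol_def single_uminus)
  then show ?thesis
    using hub_span_add[OF assms(1) hub_span_const_mult[OF assms(2), of "- 1"]] by simp
qed

lemma hub_in_hub_span:
  assumes v: "v \<in> V"
  shows "monom_pol (hub m v) \<in> hub_span"
proof -
  have "(\<Sum>w\<in>V. const_pol (of_bool (w = v)) * monom_pol (hub m w)) =
      (\<Sum>w\<in>V. if w = v then monom_pol (hub m w) else 0)"
    by (rule sum.cong) (auto simp: const_pol_def)
  also have "\<dots> = monom_pol (hub m v)"
    using v finite_V by simp
  finally have eq: "(\<Sum>w\<in>V. const_pol (of_bool (w = v)) * monom_pol (hub m w)) = monom_pol (hub m v)" .
  show ?thesis
    unfolding hub_span_def
    by (intro CollectI exI[of _ "\<lambda>w. of_bool (w = v)"]) (simp only: eq diff_self ideal_zero[OF ideal_I2])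
qed

lemma quadric_diff_in_Ann:
  assumes "{x, y, x', y'} \<subseteq> V" "T x y = T x' y'"
  shows "monom_pol {#x, y#} - monom_pol {#x', y'#} \<in> I"
proof (rule hom_part_in_Ann)
  show "monom_pol {#x, y#} - monom_pol {#x', y'#} \<in> hom_part V 2"
    by (intro hom_part_diff monom_pol_hom_part) (use assms(1) in simp_all)
  fix N :: "cubic_var multiset" assume N: "size N + 2 = 3" "set_mset N \<subseteq> V"
  then obtain v where "N = {#v#}" "v \<in> V" using size_1_singleton_mset[of N] by auto
  then show "lin (shifted N) (monom_pol {#x, y#} - monom_pol {#x', y'#}) = (0 :: 'a)"
    using in_cubic_terms_iff[of x y v] in_cubic_terms_iff[of x' y' v] in_cubic_terms_iff'[of v x y]
      in_cubic_terms_iff'[of v x' y'] assms by (simp add: lin_diff)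
qed

lemma null_quadric_in_Ann:
  assumes "{x, y} \<subseteq> V" "T x y = None"
  shows "monom_pol {#x, y#} \<in> I"
proof (rule hom_part_in_Ann)
  show "monom_pol {#x, y#} \<in> hom_part V 2"
    by (rule monom_pol_hom_part) (use assms(1) in simp_all)
  fix N :: "cubic_var multiset" assume N: "size N + 2 = 3" "set_mset N \<subseteq> V"
  then obtain v where "N = {#v#}" "v \<in> V" using size_1_singleton_mset[of N] by auto
  then show "lin (shifted N) (monom_pol {#x, y#}) = (0 :: 'a)"
    using in_cubic_terms_iff[of x y v] in_cubic_terms_iff'[of v x y] assms by simp
qed

lemma quartic_closure_hub_span: "quartic_closure m (\<lambda>M. (monom_pol M :: (cubic_var, 'k::field) mpol) \<in> hub_span)"
proof unfold_locales
  have split: "monom_pol {#x, y, z, w#} = (monom_pol {#x, y#} * monom_pol {#z, w#} :: (cubic_var, 'k) mpol)" for x y z w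
    by (simp add: monom_pol_mult add_mset_commute)
  fix x y z w x' y' z' w' :: cubic_var
  show "(monom_pol {#x, y, z, w#} :: (cubic_var, 'k) mpol) \<in> hub_span"
    if V: "{x, y, z, w, x', y', z', w'} \<subseteq> V" and T: "T x y = T x' y'" "T z w = T z' w'"
      and hub_span: "(monom_pol {#x, y, z', w'#} :: (cubic_var, 'k) mpol) \<in> hub_span"
        "(monom_pol {#x', y', z, w#} :: (cubic_var, 'k) mpol) \<in> hub_span"
        "(monom_pol {#x', y', z', w'#} :: (cubic_var, 'k) mpol) \<in> hub_span"
  proof -
    let ?q = "monom_pol {#x, y#} :: (cubic_var, 'k) mpol" and ?q' = "monom_pol {#x', y'#} :: (cubic_var, 'k) mpol"
    let ?r = "monom_pol {#z, w#} :: (cubic_var, 'k) mpol" and ?r' = "monom_pol {#z', w'#} :: (cubic_var, 'k) mpol"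
    have "(?q - ?q') * (?r - ?r') \<in> hub_span"
      using V T by (intro I2_subset_hub_span mult_in_I2 quadric_diff_in_Ann) auto
    then have "(?q - ?q') * (?r - ?r') + ?q * ?r' + ?q' * ?r - ?q' * ?r' \<in> hub_span"
      using hub_span unfolding split by (intro hub_span_add hub_span_diff)
    moreover have "(?q - ?q') * (?r - ?r') + ?q * ?r' + ?q' * ?r - ?q' * ?r' = ?q * ?r"
      by (simp add: algebra_simps)
    ultimately show ?thesis unfolding split by simp
  qed
  show "(monom_pol {#x, y, z, w#} :: (cubic_var, 'k) mpol) \<in> hub_span"
    if V: "{x, y, z, w, z', w'} \<subseteq> V" and T: "T x y = None" "T z w = T z' w'"
      and hub_span: "(monom_pol {#x, y, z', w'#} :: (cubic_var, 'k) mpol) \<in> hub_span"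
  proof -
    let ?q = "monom_pol {#x, y#} :: (cubic_var, 'k) mpol"
    let ?r = "monom_pol {#z, w#} :: (cubic_var, 'k) mpol" and ?r' = "monom_pol {#z', w'#} :: (cubic_var, 'k) mpol"
    have "?q * (?r - ?r') \<in> hub_span"
      using V T by (intro I2_subset_hub_span mult_in_I2 quadric_diff_in_Ann null_quadric_in_Ann) auto
    then have "?q * (?r - ?r') + ?q * ?r' \<in> hub_span"
      using hub_span unfolding split by (intro hub_span_add)
    then show ?thesis unfolding split by (simp add: algebra_simps)
  qed
  show "(monom_pol {#x, y, z, w#} :: (cubic_var, 'k) mpol) \<in> hub_span"
    if V: "{x, y, z, w} \<subseteq> V" and T: "T x y = None" "T z w = None"
    unfolding split using V T by (intro I2_subset_hub_span mult_in_I2 null_quadric_in_Ann) auto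
qed (use hub_in_hub_span in blast)

lemma quartic_monomial_in_hub_span:
  assumes "size M = 4" "set_mset M \<subseteq> V"
  shows "monom_pol M \<in> hub_span"
proof -
  obtain x K where "M = add_mset x K" "size K = 3"
    using size_eq_Suc_imp_eq_union[of M 3] assms by auto
  moreover then obtain y L where "K = add_mset y L" "size L = 2"
    using size_eq_Suc_imp_eq_union[of K 2] by auto
  moreover then obtain z N where "L = add_mset z N" "size N = 1"
    using size_eq_Suc_imp_eq_union[of L 1] by auto
  moreover then obtain w where "N = {#w#}"
    using size_1_singleton_mset[of N] by auto
  ultimately have "M = {#x, y, z, w#}" by simp
  then show ?thesis
    using quartic_closure.Z_quartic[OF quartic_closure_hub_span, of x y z w] assms by simp
qed

lemma hom_part_4_subset_hub_span: "s \<in> hom_part V 4 \<Longrightarrow> s \<in> hub_span"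
  by (rule hom_part_induct[of s V 4 "\<lambda>s. s \<in> hub_span"])
    (simp_all add: hub_span_add hub_span_const_mult quartic_monomial_in_hub_span I2_subset_hub_span ideal_zero[OF ideal_I2])

lemma hilbert_square_4: "hilbert_value V (I2 :: (cubic_var, 'k::field) mpol set) 4 (card V)"
proof (rule hilbert_valueI[where b = "\<lambda>v. monom_pol (hub m v)" and g = deriv_coeff])
  show "monom_pol (hub m v) \<in> hom_part V 4" if "v \<in> V" for v
    using hub_subset[OF that] by (intro monom_pol_hom_part) simp_all
  show "s \<in> I2" if s: "s \<in> hom_part V 4" and z: "\<And>v. v \<in> V \<Longrightarrow> lin (deriv_coeff v) s = 0"
    for s :: "(cubic_var, 'k) mpol"
  proof -
    obtain c where c: "s - (\<Sum>v\<in>V. const_pol (c v) * monom_pol (hub m v)) \<in> I2"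
      using hom_part_4_subset_hub_span[OF s] unfolding hub_span_def by blast
    \<comment> \<open>The functional of \<open>w\<close> vanishes on \<open>s\<close> and on
      \<open>I2\<close>, and it reads off \<open>c w\<close> from the combination of hubs.\<close>
    have "c w = 0" if w: "w \<in> V" for w
    proof -
      have "lin (deriv_coeff w) (\<Sum>v\<in>V. const_pol (c v) * monom_pol (hub m v)) = (\<Sum>v\<in>V. if w = v then c v else 0)"
        unfolding lin_sum lin_const_mult using w by (intro sum.cong) (auto simp: hub_dual)
      also have "\<dots> = c w" using w finite_V by simp
      finally show ?thesis
        using lin_deriv_coeff_I2[OF c, of w] z[OF w] by (simp add: lin_diff)
    qed
    then have "(\<Sum>v\<in>V. const_pol (c v) * monom_pol (hub m v)) = 0"
      by (intro sum.neutral) (simp add: const_pol_def)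
    then show ?thesis using c by simp
  qed
qed (simp_all add: ideal_I2 finite_V lin_deriv_coeff_I2 hub_dual)

section \<open>The square of the apolar ideal in degree five\<close>

lemma hub_presentations:
  assumes "v \<in> V"
  obtains z r s z' r' s' where "hub m v = {#v, z, r, s#}" "hub m v = {#v, z', r', s'#}" "z \<noteq> z'"
    "T v z = None" "T v z' = None" "T r s = Some z" "T r' s' = Some z'"
proof (cases v)
  case (VA i)
  show ?thesis
  \<comment> \<open>Besides e, a_i is null with c_1 unless \<open>i = S 0\<close>; in that case b_0
    is the second null partner.\<close>
  proof (cases "i = S 0")
    case True
    then show ?thesis using assms VA
      by (intro that[of VE "VB 0" "VC (S 0)" "VB 0" VE "VC (S 0)"]) (simp_all add: add_mset_commute)
  next
    case False
    then show ?thesis using assms VA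
      by (intro that[of VE "VB 0" "VC (S 0)" "VC (S 0)" VE "VB 0"]) (simp_all add: add_mset_commute)
  qed
next
  case (VB i)
  then show ?thesis using assms
    by (intro that[of "VB (S (S (S i)))" VD "VA (S (S i))" "VA (S (S i))" VD "VB (S (S (S i)))"])
      (simp_all add: add_mset_commute)
next
  case (VC i)
  show ?thesis
  proof (cases "i = 0")
    case True
    then show ?thesis using assms VC
      by (intro that[of VD "VA 0" "VB (S 0)" "VB (S 0)" VD "VA 0"]) (simp_all add: add_mset_commute)
  next
    case False
    then show ?thesis using assms VC
      by (intro that[of VD "VA 0" "VB (S 0)" "VA 0" VD "VB (S 0)"]) (simp_all add: add_mset_commute)
  qed
next
  case VD
  then show ?thesis
    by (intro that[of VE "VB 0" "VC (S 0)" "VC (S 0)" VE "VB 0"]) (simp_all add: add_mset_commute)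
next
  case VE
  then show ?thesis
    by (intro that[of VD "VA 0" "VB (S 0)" "VA 0" VD "VB (S 0)"]) (simp_all add: add_mset_commute)
qed

lemma var_mult_hub_in_I2:
  assumes y: "y \<in> V" and v: "v \<in> V"
  shows "(monom_pol (add_mset y (hub m v)) :: (cubic_var, 'k::field) mpol) \<in> I2"
proof -
  have *: "(monom_pol (add_mset y (hub m v)) :: (cubic_var, 'k) mpol) \<in> I2"
    if h: "hub m v = {#v, z, r, s#}" "T v z = None" "T r s = Some z" and yz: "y \<noteq> z" for z r s
  proof -
    have V: "{v, z, r, s} \<subseteq> V" using hub_subset[OF v] h by simp
    have "(monom_pol {#y, r, s#} :: (cubic_var, 'k) mpol) \<in> I"
    proof (rule hom_part_in_Ann)
      show "(monom_pol {#y, r, s#} :: (cubic_var, 'k) mpol) \<in> hom_part V 3"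
        by (rule monom_pol_hom_part) (use y V in simp_all)
      show "lin (shifted N) (monom_pol {#y, r, s#}) = (0 :: 'k)" if "size N + 3 = 3" for N
        using that in_cubic_terms_iff'[of y r s] y V h yz by simp
    qed
    then have "monom_pol {#v, z#} * (monom_pol {#y, r, s#} :: (cubic_var, 'k) mpol) \<in> I2"
      using V h by (intro mult_in_I2 null_quadric_in_Ann) simp_all
    then show ?thesis
      unfolding monom_pol_mult h by (simp add: add_mset_commute)
  qed
  obtain z r s z' r' s' where "hub m v = {#v, z, r, s#}" "hub m v = {#v, z', r', s'#}" "z \<noteq> z'"
    "T v z = None" "T v z' = None" "T r s = Some z" "T r' s' = Some z'"
    by (rule hub_presentations[OF v])
  then show ?thesis
    using *[of z r s] *[of z' r' s'] by (cases "y = z") blast+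
qed

lemma quintic_monomial_in_I2:
  assumes "size M = 5" "set_mset M \<subseteq> V"
  shows "(monom_pol M :: (cubic_var, 'k::field) mpol) \<in> I2"
proof -
  obtain y K where M: "M = add_mset y K" and K: "size K = 4"
    using size_eq_Suc_imp_eq_union[of M 4] assms by auto
  have y: "y \<in> V" and "set_mset K \<subseteq> V" using assms M by simp_all
  then have "(monom_pol K :: (cubic_var, 'k) mpol) \<in> hub_span"
    using quartic_monomial_in_hub_span K by blast
  then obtain c :: "cubic_var \<Rightarrow> 'k" where c: "monom_pol K - (\<Sum>v\<in>V. const_pol (c v) * monom_pol (hub m v)) \<in> I2"
    unfolding hub_span_def by blast
  have prod: "monom_pol {#y#} * monom_pol L = (monom_pol (add_mset y L) :: (cubic_var, 'k) mpol)" for L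
    by (simp add: monom_pol_mult)
  then have const_prod: "monom_pol {#y#} * (const_pol a * monom_pol L) =
      (const_pol a * monom_pol (add_mset y L) :: (cubic_var, 'k) mpol)" for a L
    by (metis mult.left_commute)
  let ?D = "monom_pol K - (\<Sum>v\<in>V. const_pol (c v) * monom_pol (hub m v))"
  let ?E = "\<Sum>v\<in>V. const_pol (c v) * monom_pol (add_mset y (hub m v))"
  have "monom_pol {#y#} * ?D \<in> I2"
    using y by (intro ideal_mult[OF ideal_I2 c] monom_pol_carrier) simp
  moreover have "?E \<in> I2"
    by (rule ideal_sum[OF ideal_I2], rule ideal_mult[OF ideal_I2 var_mult_hub_in_I2[OF y] carrier_const])
  ultimately have "monom_pol {#y#} * ?D + ?E \<in> I2"
    by (rule ideal_add[OF ideal_I2])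
  moreover have "monom_pol {#y#} * ?D + ?E = monom_pol M"
    by (simp add: M right_diff_distrib sum_distrib_left prod const_prod)
  ultimately show ?thesis by simp
qed

lemma hom_part_5_subset_I2: "s \<in> hom_part V 5 \<Longrightarrow> s \<in> I2"
  by (rule hom_part_induct[of s V 5 "\<lambda>s. s \<in> I2"])
    (simp_all add: ideal_zero[OF ideal_I2] ideal_add[OF ideal_I2] ideal_mult[OF ideal_I2] carrier_const quintic_monomial_in_I2)

lemma hilbert_square_5: "hilbert_value V (I2 :: (cubic_var, 'k::field) mpol set) 5 0"
proof -
  have "hilbert_value V (I2 :: (cubic_var, 'k) mpol set) 5 (card ({} :: unit set))"
    \<comment> \<open>The index set is empty, so \<open>b\<close> and \<open>g\<close> are
      placeholders and only completeness has content.\<close>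
    by (rule hilbert_valueI[where b = "\<lambda>_. 0" and g = "\<lambda>_. shifted {#}"])
      (simp_all add: ideal_I2 hom_part_5_subset_I2)
  then show ?thesis by simp
qed

lemma cubic_form_hom: "F \<in> dual_hom_part V 3"
proof -
  have "set_mset M \<subseteq> V \<and> size M = 3" if "Dual (monom_of M) \<in> Poly_Mapping.keys (F :: (cubic_var, 'a) dpol)" for M
    using that cubic_terms_subset[of M] cubic_terms_size[of M] by (simp add: in_keys_iff of_bool_def split: if_splits)
  then have "Poly_Mapping.keys \<mu> \<subseteq> V \<and> mdeg \<mu> = 3" if "Dual \<mu> \<in> Poly_Mapping.keys (F :: (cubic_var, 'a) dpol)" for \<mu>
    using that monom_of_exhaust[of \<mu>] by (metis keys_monom_of mdeg_monom_of)
  then show ?thesis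
    unfolding dual_hom_part_def dual_module_def by blast
qed

end

theorem proposition3p24:
  fixes m :: nat
  assumes "m \<ge> 6"
  shows "small_tangent_space (cubic_vars m) (cubic_form m :: (cubic_var, 'k::field) dpol)"
proof -
  interpret cubic_indices m using assms by unfold_locales
  show ?thesis
    unfolding small_tangent_space_def Let_def
    using cubic_form_hom hilbert_Ann hilbert_square_4 hilbert_square_5 by blast
qed

end
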